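(* Let $\Delta'$ be any smooth polytope with integral vertices. Then for some positive integer $k$ the multiple $k\Delta'$ is integrally affine equivalent to a face in a monotone polytope $\Delta$ all of whose facets are pervasive and powerful.
   Context: All polytopes are compact, full dimensional, simple ($n$ facets meet at each vertex, where $n$ is the dimension), rational and smooth (at each vertex the $n$ primitive integral outward conormals of the facets through it form a basis of the integer lattice). A facet $F$ of a polytope is pervasive if it meets all other facets, and powerful if there is an edge between $F$ and every vertex of the polytope not on $F$ (i.e. for each vertex $v\notin F$ some edge joins $v$ to a vertex of $F$). A monotone polytope is the moment polytope of a toric symplectic manifold $(M,\omega)$ with $[\omega]=c_1(M)$; equivalently, after a translation, a smooth polytope $\{\xi:\langle\eta_i,\xi\rangle\le\kappa_i,\ i=1,\dots,N\}$ (with $\eta_i$ the primitive integral outward conormals of its facets) all of whose support constants $\kappa_i$ equal $1$. *)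

theory Defs
  imports "HOL-Analysis.Analysis" "HOL-Library.Function_Algebras"
begin

(* The dimension of the polytope to be constructed is existentially quantified, so it cannot be
   a type. R^n is the subspace of nat => real of functions supported on {..<n}; all these spaces
   live in one real vector space, on which the library notions convex hull, affine hull,
   polytope, face_of, extreme_point_of and dim are available. *)

instantiation "fun" :: (type, real_vector) real_vector
begin

definition scaleR_fun_def: "r *\<^sub>R f = (\<lambda>x. r *\<^sub>R f x)"

instance
  by standard
    (simp_all add: scaleR_fun_def fun_eq_iff scaleR_add_right scaleR_add_left)

end

definition Rspace :: "nat \<Rightarrow> (nat \<Rightarrow> real) set" where
  "Rspace n = {x. \<forall>i\<ge>n. x i = 0}"

definition Zlattice :: "nat \<Rightarrow> (nat \<Rightarrow> real) set" where
  "Zlattice n = {x \<in> Rspace n. \<forall>i<n. x i \<in> \<int>}"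

definition pairing :: "nat \<Rightarrow> (nat \<Rightarrow> real) \<Rightarrow> (nat \<Rightarrow> real) \<Rightarrow> real" where
  "pairing n \<eta> \<xi> = (\<Sum>i<n. \<eta> i * \<xi> i)"

(* Excludes 0, since 0 = k * 0 for every k. *)
definition primitive_vector :: "nat \<Rightarrow> (nat \<Rightarrow> real) \<Rightarrow> bool" where
  "primitive_vector n \<eta> \<longleftrightarrow> \<eta> \<in> Zlattice n \<and>
     (\<forall>k::int. \<forall>\<zeta>\<in>Zlattice n. \<eta> = of_int k *\<^sub>R \<zeta> \<longrightarrow> \<bar>k\<bar> = 1)"

definition lattice_basis :: "nat \<Rightarrow> (nat \<Rightarrow> real) set \<Rightarrow> bool" where
  "lattice_basis n B \<longleftrightarrow> finite B \<and> B \<subseteq> Zlattice n \<and>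
     (\<forall>c::(nat \<Rightarrow> real) \<Rightarrow> int. (\<Sum>b\<in>B. of_int (c b) *\<^sub>R b) = 0 \<longrightarrow> (\<forall>b\<in>B. c b = 0)) \<and>
     (\<forall>z\<in>Zlattice n. \<exists>c::(nat \<Rightarrow> real) \<Rightarrow> int. z = (\<Sum>b\<in>B. of_int (c b) *\<^sub>R b))"

(* Replaces the library's aff_dim, facet_of and edge_of, which require a Euclidean space.
   The affine dimension is that of the space of directions; it is natural-number valued, so
   nonemptiness is always imposed separately. *)
definition affine_dim :: "(nat \<Rightarrow> real) set \<Rightarrow> nat" where
  "affine_dim S = dim {x - y |x y. x \<in> S \<and> y \<in> S}"

definition is_facet :: "(nat \<Rightarrow> real) set \<Rightarrow> (nat \<Rightarrow> real) set \<Rightarrow> bool" where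
  "is_facet P F \<longleftrightarrow> F face_of P \<and> F \<noteq> {} \<and> affine_dim F + 1 = affine_dim P"

definition is_edge :: "(nat \<Rightarrow> real) set \<Rightarrow> (nat \<Rightarrow> real) set \<Rightarrow> bool" where
  "is_edge P e \<longleftrightarrow> e face_of P \<and> affine_dim e = 1"

(* For a full-dimensional polytope P and a facet F there is at most one such \<eta>. *)
definition outward_conormal ::
    "nat \<Rightarrow> (nat \<Rightarrow> real) set \<Rightarrow> (nat \<Rightarrow> real) set \<Rightarrow> (nat \<Rightarrow> real) \<Rightarrow> bool" where
  "outward_conormal n P F \<eta> \<longleftrightarrow> primitive_vector n \<eta> \<and>
     (\<exists>\<kappa>. (\<forall>\<xi>\<in>P. pairing n \<eta> \<xi> \<le> \<kappa>) \<and> F = {\<xi>\<in>P. pairing n \<eta> \<xi> = \<kappa>})"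

(* The conjuncts after nonemptiness: full dimensional, simple, rational, smooth. *)
definition smooth_polytope :: "nat \<Rightarrow> (nat \<Rightarrow> real) set \<Rightarrow> bool" where
  "smooth_polytope n P \<longleftrightarrow>
     polytope P \<and> P \<subseteq> Rspace n \<and> P \<noteq> {} \<and>
     affine_dim P = n \<and>
     (\<forall>v. v extreme_point_of P \<longrightarrow> card {F. is_facet P F \<and> v \<in> F} = n) \<and>
     (\<forall>F. is_facet P F \<longrightarrow> (\<exists>\<eta>. outward_conormal n P F \<eta>)) \<and>
     (\<forall>v. v extreme_point_of P \<longrightarrow>
        lattice_basis n {\<eta>. \<exists>F. is_facet P F \<and> v \<in> F \<and> outward_conormal n P F \<eta>})"

definition integral_vertices :: "nat \<Rightarrow> (nat \<Rightarrow> real) set \<Rightarrow> bool" where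
  "integral_vertices n P \<longleftrightarrow> (\<forall>v. v extreme_point_of P \<longrightarrow> v \<in> Zlattice n)"

definition monotone_polytope :: "nat \<Rightarrow> (nat \<Rightarrow> real) set \<Rightarrow> bool" where
  "monotone_polytope n P \<longleftrightarrow> smooth_polytope n P \<and>
     (\<exists>t\<in>Rspace n. let Q = (\<lambda>\<xi>. t + \<xi>) ` P in
        Q = {\<xi>\<in>Rspace n. \<forall>F \<eta>. is_facet Q F \<and> outward_conormal n Q F \<eta> \<longrightarrow> pairing n \<eta> \<xi> \<le> 1})"

definition is_pervasive :: "(nat \<Rightarrow> real) set \<Rightarrow> (nat \<Rightarrow> real) set \<Rightarrow> bool" where
  "is_pervasive P F \<longleftrightarrow> (\<forall>G. is_facet P G \<and> G \<noteq> F \<longrightarrow> F \<inter> G \<noteq> {})"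

definition is_powerful :: "(nat \<Rightarrow> real) set \<Rightarrow> (nat \<Rightarrow> real) set \<Rightarrow> bool" where
  "is_powerful P F \<longleftrightarrow> (\<forall>v. v extreme_point_of P \<and> v \<notin> F \<longrightarrow>
     (\<exists>e w. is_edge P e \<and> v \<in> e \<and> w extreme_point_of P \<and> w \<in> F \<and> w \<in> e))"

(* The ambient dimensions may differ: the affine map need only identify the affine hulls,
   together with their lattice points. Meant for polytopes with integral vertices. *)
definition integrally_affine_equivalent ::
    "nat \<Rightarrow> (nat \<Rightarrow> real) set \<Rightarrow> nat \<Rightarrow> (nat \<Rightarrow> real) set \<Rightarrow> bool" where
  "integrally_affine_equivalent n P m Q \<longleftrightarrow>
     (\<exists>(L :: (nat \<Rightarrow> real) \<Rightarrow> (nat \<Rightarrow> real)) b. linear L \<and>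
        (let \<phi> = (\<lambda>x. L x + b) in
           bij_betw \<phi> (affine hull P) (affine hull Q) \<and>
           \<phi> ` (affine hull P \<inter> Zlattice n) = affine hull Q \<inter> Zlattice m \<and>
           \<phi> ` P = Q))"

end

theory Submission
  imports Defs
begin

text \<open>Write \<open>\<Delta>'\<close> as the set of all \<open>\<xi>\<close> with \<open>\<langle>a\<^sub>i, \<xi>\<rangle> \<le> b\<^sub>i\<close>, one inequality for each facet,
  \<open>a\<^sub>i\<close> the outward conormal. The vertices are integral, hence so are the \<open>b\<^sub>i\<close>, and a multiple
  of \<open>\<Delta>'\<close> can be translated by an integral vector so that every support constant becomes
  \<open>1 + r\<^sub>i\<close> with an integer \<open>r\<^sub>i \<ge> 1\<close>. Take the factor \<open>k\<close> to be twice the number of vertices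
  and translate by minus twice the sum of the vertices, so that the new constant is
  \<open>2 \<Sum>\<^sub>v (b\<^sub>i - \<langle>a\<^sub>i, v\<rangle>)\<close>: each term is a nonnegative integer, and one of them is positive
  because some vertex is off the facet.\<close>

text \<open>Now spread each constant over new coordinates \<open>u\<^sub>i\<^sub>j\<close>, \<open>j < r\<^sub>i\<close>: replace the \<open>i\<close>-th
  inequality by \<open>- u\<^sub>i\<^sub>j \<le> 1\<close> and \<open>\<langle>a\<^sub>i, x\<rangle> + \<Sum>\<^sub>j u\<^sub>i\<^sub>j \<le> 1\<close>. All support constants are \<open>1\<close>. The
  \<open>r\<^sub>i + 1\<close> inequalities of group \<open>i\<close> have nonnegative slacks whose sum is the slack
  \<open>1 + r\<^sub>i - \<langle>a\<^sub>i, x\<rangle>\<close> of the inequality they replace. So the new polytope is fibred over the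
  old one by products of simplices, the \<open>i\<close>-th simplex shrinking to a point exactly over the
  \<open>i\<close>-th facet (it is an iterated expansion, or wedge, along all facets). A vertex is a vertex
  \<open>x\<close> of the old polytope together with a vertex of the \<open>i\<close>-th simplex for each facet \<open>i\<close> that
  misses \<open>x\<close>, and smoothness at \<open>x\<close> gives smoothness above it (\<open>conormals_generate\<close>). The old
  polytope is the face where all \<open>u\<^sub>i\<^sub>j\<close> are \<open>-1\<close> (\<open>core_face\<close>).\<close>

text \<open>Both combinatorial properties come from \<open>r\<^sub>i \<ge> 1\<close>, that is, from each simplex having at
  least two vertices. Two facets of the same group \<open>i\<close> meet over the \<open>i\<close>-th facet of the old
  polytope, and two facets of different groups meet over every point (\<open>facets_pervasive\<close>). If a
  vertex is off a facet of group \<open>i\<close>, then its inequality carries all the slack of the group,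
  and moving the slack to another inequality of the group runs along an edge to a vertex on the
  facet (\<open>facets_powerful\<close>).\<close>

text \<open>Facets, edges and smoothness are defined by faces and dimensions, while the argument needs
  inequalities. The locale \<open>smooth_presentation\<close> describes a polytope by inequalities whose
  conormals at each vertex form a lattice basis; the facets, conormals and smoothness of such a
  polytope are read off from its inequalities. Conversely a smooth polytope is cut out by its
  facet inequalities (\<open>smooth_polytope_presentation\<close>); this rests on the fact that every nonzero
  vertex of the polar of a full-dimensional polytope supports a facet
  (\<open>polytope_facet_presentation\<close>).\<close>

section \<open>Linear algebra in the coordinate subspaces\<close>

lemma sum_fun_apply: "(\<Sum>i\<in>I. f i) x = (\<Sum>i\<in>I. f i x)"
  for f :: "'b \<Rightarrow> 'a \<Rightarrow> 'c::comm_monoid_add"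
  by (induction I rule: infinite_finite_induct) auto

lemma pairing_commute: "pairing n x y = pairing n y x"
  by (simp add: pairing_def mult.commute)

lemma pairing_add_right: "pairing n x (y + z) = pairing n x y + pairing n x z"
  by (simp add: pairing_def sum.distrib algebra_simps)

lemma pairing_diff_right: "pairing n x (y - z) = pairing n x y - pairing n x z"
  by (simp add: pairing_def sum_subtractf algebra_simps)

lemma pairing_minus_right: "pairing n x (- y) = - pairing n x y"
  by (simp add: pairing_def sum_negf)

lemma pairing_scaleR_right: "pairing n x (c *\<^sub>R y) = c * pairing n x y"
  by (simp add: pairing_def scaleR_fun_def sum_distrib_left mult_ac)

lemma pairing_zero_right: "pairing n x 0 = 0"
  by (simp add: pairing_def)

lemma pairing_sum_right: "pairing n x (\<Sum>i\<in>I. f i) = (\<Sum>i\<in>I. pairing n x (f i))"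
  by (simp add: pairing_def sum_fun_apply sum_distrib_left) (rule sum.swap)

lemmas pairing_right = pairing_add_right pairing_diff_right pairing_minus_right
  pairing_scaleR_right pairing_zero_right pairing_sum_right

lemma pairing_add_left: "pairing n (y + z) x = pairing n y x + pairing n z x"
  and pairing_diff_left: "pairing n (y - z) x = pairing n y x - pairing n z x"
  and pairing_minus_left: "pairing n (- y) x = - pairing n y x"
  and pairing_scaleR_left: "pairing n (c *\<^sub>R y) x = c * pairing n y x"
  and pairing_zero_left: "pairing n 0 x = 0"
  by (simp_all add: pairing_commute[of n _ x] pairing_right)

lemma pairing_sum_left: "pairing n (\<Sum>i\<in>I. f i) x = (\<Sum>i\<in>I. pairing n (f i) x)"
  by (simp add: pairing_commute[of n _ x] pairing_right)

lemmas pairing_linear = pairing_right pairing_add_left pairing_diff_left pairing_minus_left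
  pairing_scaleR_left pairing_zero_left pairing_sum_left

lemma subspace_Rspace: "subspace (Rspace n)"
  by (auto simp: subspace_def Rspace_def scaleR_fun_def)

lemmas Rspace_closed = subspace_add[OF subspace_Rspace] subspace_diff[OF subspace_Rspace]
  subspace_scale[OF subspace_Rspace] subspace_0[OF subspace_Rspace] subspace_neg[OF subspace_Rspace]
  subspace_sum[OF subspace_Rspace]

lemma Zlattice_imp_Rspace: "x \<in> Zlattice n \<Longrightarrow> x \<in> Rspace n"
  by (simp add: Zlattice_def)

lemma Zlattice_iff: "x \<in> Zlattice n \<longleftrightarrow> x \<in> Rspace n \<and> (\<forall>i. x i \<in> \<int>)"
  by (auto simp: Zlattice_def Rspace_def) (metis Ints_0 not_le)

lemma Zlattice_add: "x \<in> Zlattice n \<Longrightarrow> y \<in> Zlattice n \<Longrightarrow> x + y \<in> Zlattice n"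
  and Zlattice_diff: "x \<in> Zlattice n \<Longrightarrow> y \<in> Zlattice n \<Longrightarrow> x - y \<in> Zlattice n"
  and Zlattice_scale: "x \<in> Zlattice n \<Longrightarrow> of_int k *\<^sub>R x \<in> Zlattice n"
  and Zlattice_zero: "0 \<in> Zlattice n"
  by (auto simp: Zlattice_iff Rspace_def scaleR_fun_def)

lemma Zlattice_sum: "(\<And>i. i \<in> I \<Longrightarrow> f i \<in> Zlattice n) \<Longrightarrow> (\<Sum>i\<in>I. f i) \<in> Zlattice n"
  by (induction I rule: infinite_finite_induct) (auto simp: Zlattice_zero Zlattice_add)

lemma pairing_Ints: "x \<in> Zlattice n \<Longrightarrow> y \<in> Zlattice n \<Longrightarrow> pairing n x y \<in> \<int>"
  by (auto simp: pairing_def Zlattice_iff intro!: Ints_mult)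

definition unit_vector :: "nat \<Rightarrow> nat \<Rightarrow> real" where
  "unit_vector k = (\<lambda>i. if i = k then 1 else 0)"

lemma unit_vector_Zlattice: "k < n \<Longrightarrow> unit_vector k \<in> Zlattice n"
  by (auto simp: Zlattice_iff Rspace_def unit_vector_def)

lemma pairing_unit_vector: "k < n \<Longrightarrow> pairing n x (unit_vector k) = x k"
  by (simp add: pairing_def unit_vector_def if_distrib cong: if_cong)

lemma Rspace_expand: "x \<in> Rspace n \<Longrightarrow> x = (\<Sum>k<n. x k *\<^sub>R unit_vector k)"
  by (rule ext)
    (auto simp: sum_fun_apply scaleR_fun_def unit_vector_def Rspace_def if_distrib cong: if_cong)

lemma pairing_eq_0_imp_zero:
  assumes "x \<in> Rspace n" "\<And>y. y \<in> Rspace n \<Longrightarrow> pairing n x y = 0"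
  shows "x = 0"
proof
  fix k show "x k = 0 k"
  proof (cases "k < n")
    case True
    then show ?thesis
      using assms(2)[of "unit_vector k"] unit_vector_Zlattice[of k n]
      by (simp add: pairing_unit_vector Zlattice_imp_Rspace)
  qed (use assms(1) in \<open>auto simp: Rspace_def\<close>)
qed

text \<open>Pairing a vanishing combination of the \<open>u i\<close> with \<open>w j\<close> isolates its \<open>j\<close>-th coefficient.
  The independence of unit vectors, lattice bases and edge directions is obtained in this way.\<close>

lemma biorthogonal_independent:
  assumes fin: "finite I"
    and bi: "\<And>i j. i \<in> I \<Longrightarrow> j \<in> I \<Longrightarrow> pairing n (u i) (w j) = (if i = j then 1 else 0)"
  shows "inj_on u I" and "independent (u ` I)"
proof -
  show inj: "inj_on u I"
    by (rule inj_onI) (metis bi zero_neq_one)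
  show "independent (u ` I)"
  proof
    assume "dependent (u ` I)"
    then obtain c j where j: "j \<in> I" "c (u j) \<noteq> 0" and z: "(\<Sum>v\<in>u ` I. c v *\<^sub>R v) = 0"
      using fin by (auto simp: dependent_finite)
    have "0 = pairing n (\<Sum>i\<in>I. c (u i) *\<^sub>R u i) (w j)"
      using z inj by (simp add: sum.reindex pairing_linear)
    also have "\<dots> = (\<Sum>i\<in>I. if i = j then c (u i) else 0)"
      using j bi by (auto simp: pairing_linear intro!: sum.cong)
    also have "\<dots> = c (u j)" using fin j by simp
    finally show False using j by simp
  qed
qed

lemma independent_unit_vectors:
  "inj_on unit_vector {..<n}" "independent (unit_vector ` {..<n})"
  by (rule biorthogonal_independent[of "{..<n}" n unit_vector unit_vector];
      simp add: pairing_unit_vector; simp add: unit_vector_def)+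

lemma span_unit_vectors: "span (unit_vector ` {..<n}) = Rspace n"
proof
  show "span (unit_vector ` {..<n}) \<subseteq> Rspace n"
    by (rule span_minimal)
      (use unit_vector_Zlattice subspace_Rspace Zlattice_imp_Rspace in auto)
  show "Rspace n \<subseteq> span (unit_vector ` {..<n})"
  proof
    fix x assume "x \<in> Rspace n"
    then show "x \<in> span (unit_vector ` {..<n})"
      by (subst Rspace_expand) (auto intro!: span_sum span_scale intro: span_base)
  qed
qed

lemma dim_Rspace: "dim (Rspace n) = n"
  using dim_eq_card[of "unit_vector ` {..<n}" "Rspace n"] independent_unit_vectors[of n]
  by (simp add: span_unit_vectors card_image subspace_Rspace[THEN span_eq_iff[THEN iffD2]])

lemma span_Rspace_subset: "S \<subseteq> Rspace n \<Longrightarrow> span S \<subseteq> Rspace n"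
  by (simp add: span_minimal subspace_Rspace)

lemma independent_Rspace:
  assumes "independent B" "B \<subseteq> Rspace n"
  shows "finite B" "card B \<le> n"
  using independent_span_bound[of "unit_vector ` {..<n}" B] assms independent_unit_vectors[of n]
  by (auto simp: span_unit_vectors card_image)

lemma dim_insert_new:
  assumes "S \<subseteq> Rspace n" "u \<in> Rspace n" "u \<notin> span S"
  shows "dim (insert u S) = dim S + 1"
proof -
  obtain B where B: "B \<subseteq> S" "independent B" "S \<subseteq> span B" "card B = dim S"
    by (rule basis_exists)
  have eq: "span B = span S"
    using B by (meson span_mono span_minimal subspace_span subset_antisym)
  have ind: "independent (insert u B)"
    using assms B by (intro independent_insertI) (auto simp: eq)
  have "u \<notin> B" using assms B span_base by blast
  have fin: "finite B" using B assms independent_Rspace by blast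
  have "insert u S \<subseteq> span (insert u B)"
    using B span_mono[of B "insert u B"] by (auto intro: span_base)
  then have "dim (insert u S) = card (insert u B)"
    using B ind by (intro dim_unique) auto
  then show ?thesis using fin \<open>u \<notin> B\<close> B by simp
qed

lemma span_eq_Rspace_iff_dim:
  assumes "S \<subseteq> Rspace n"
  shows "span S = Rspace n \<longleftrightarrow> dim S = n"
proof
  show "span S = Rspace n \<Longrightarrow> dim S = n" by (metis dim_Rspace dim_span)
  assume d: "dim S = n"
  show "span S = Rspace n"
  proof (rule ccontr)
    assume "span S \<noteq> Rspace n"
    then obtain x where x: "x \<in> Rspace n" "x \<notin> span S"
      using span_Rspace_subset[OF assms] by auto
    then have "dim (insert x S) = n + 1" using dim_insert_new[OF assms] d by simp
    moreover obtain B where "B \<subseteq> insert x S" "independent B" "card B = dim (insert x S)"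
      using basis_exists by metis
    ultimately show False using independent_Rspace[of B n] x assms by auto
  qed
qed

text \<open>A linear functional that kills \<open>S\<close> but not \<open>x\<close> exists because an independent subset of \<open>S\<close>
  stays independent after adding \<open>x\<close>; on \<^term>\<open>Rspace n\<close> it is the pairing with the vector of its
  values on the unit vectors. This does the work of an orthogonal complement.\<close>

lemma separating_vector:
  assumes "S \<subseteq> Rspace n" "x \<in> Rspace n" "x \<notin> span S"
  obtains d where "d \<in> Rspace n" "\<And>s. s \<in> S \<Longrightarrow> pairing n d s = 0" "pairing n d x = 1"
proof -
  obtain B where B: "B \<subseteq> S" "independent B" "S \<subseteq> span B" "card B = dim S"
    by (rule basis_exists)
  have x: "x \<notin> span B" using assms(3) B span_mono by blast
  obtain g :: "(nat \<Rightarrow> real) \<Rightarrow> real" where g: "linear g"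
    "\<forall>y\<in>insert x B. g y = (if y = x then 1 else 0)"
    using linear_independent_extend[OF independent_insertI[OF x B(2)],
        of "\<lambda>y. if y = x then 1 else 0"] by auto
  define d where "d = (\<lambda>k. if k < n then g (unit_vector k) else 0)"
  have gd: "g y = pairing n d y" if "y \<in> Rspace n" for y
    using that
    by (subst Rspace_expand)
      (auto simp: d_def pairing_def linear_sum[OF g(1)] linear_cmul[OF g(1)] intro!: sum.cong)
  have "g b = 0" if "b \<in> B" for b using g(2) that x span_base by auto
  then have "g s = 0" if "s \<in> S" for s
    using linear_eq_0_on_span[OF g(1), of B] B that by auto
  then show ?thesis
    using that[of d] assms gd g(2) by (auto simp: d_def Rspace_def subset_iff)
qed

lemma span_eq_Rspace_iff:
  assumes "S \<subseteq> Rspace n"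
  shows "span S = Rspace n \<longleftrightarrow> (\<forall>d\<in>Rspace n. (\<forall>s\<in>S. pairing n d s = 0) \<longrightarrow> d = 0)"
proof
  assume sp: "span S = Rspace n"
  show "\<forall>d\<in>Rspace n. (\<forall>s\<in>S. pairing n d s = 0) \<longrightarrow> d = 0"
  proof (intro ballI impI)
    fix d assume d: "d \<in> Rspace n" "\<forall>s\<in>S. pairing n d s = 0"
    have "subspace {y. pairing n d y = 0}"
      by (auto simp: subspace_def pairing_linear)
    then have "span S \<subseteq> {y. pairing n d y = 0}"
      using d by (intro span_minimal) auto
    then show "d = 0" using d sp by (intro pairing_eq_0_imp_zero[of d n]) auto
  qed
next
  assume r: "\<forall>d\<in>Rspace n. (\<forall>s\<in>S. pairing n d s = 0) \<longrightarrow> d = 0"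
  show "span S = Rspace n"
  proof (rule ccontr)
    assume "span S \<noteq> Rspace n"
    then obtain x where x: "x \<in> Rspace n" "x \<notin> span S"
      using span_Rspace_subset[OF assms] by auto
    from separating_vector[OF assms this] r show False
      by (metis pairing_zero_left zero_neq_one)
  qed
qed

section \<open>Lattice bases\<close>

definition zspan :: "(nat \<Rightarrow> real) set \<Rightarrow> (nat \<Rightarrow> real) set" where
  "zspan B = {z. \<exists>c::(nat \<Rightarrow> real) \<Rightarrow> int. z = (\<Sum>b\<in>B. of_int (c b) *\<^sub>R b)}"

lemma zspan_base:
  assumes "finite B" "b \<in> B" shows "b \<in> zspan B"
proof -
  have "b = (\<Sum>x\<in>B. if x = b then b else 0)" using assms by simp
  also have "\<dots> = (\<Sum>x\<in>B. of_int (if x = b then 1 else 0) *\<^sub>R x)"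
    by (rule sum.cong) auto
  finally show ?thesis unfolding zspan_def
    by (intro CollectI exI[of _ "\<lambda>x. if x = b then 1 else 0"])
qed

lemma zspan_zero: "0 \<in> zspan B"
  unfolding zspan_def by (auto intro!: exI[of _ "\<lambda>_. 0"])

lemma zspan_add: "x \<in> zspan B \<Longrightarrow> y \<in> zspan B \<Longrightarrow> x + y \<in> zspan B"
  unfolding zspan_def
proof clarify
  fix c d :: "(nat \<Rightarrow> real) \<Rightarrow> int"
  show "\<exists>e::(nat \<Rightarrow> real) \<Rightarrow> int. (\<Sum>b\<in>B. real_of_int (c b) *\<^sub>R b) + (\<Sum>b\<in>B. real_of_int (d b) *\<^sub>R b) =
        (\<Sum>b\<in>B. real_of_int (e b) *\<^sub>R b)"
    by (rule exI[of _ "\<lambda>b. c b + d b"]) (simp add: sum.distrib scaleR_add_left)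
qed

lemma zspan_scale: "x \<in> zspan B \<Longrightarrow> of_int k *\<^sub>R x \<in> zspan B"
  unfolding zspan_def
proof clarify
  fix c :: "(nat \<Rightarrow> real) \<Rightarrow> int"
  show "\<exists>e::(nat \<Rightarrow> real) \<Rightarrow> int. real_of_int k *\<^sub>R (\<Sum>b\<in>B. real_of_int (c b) *\<^sub>R b) =
        (\<Sum>b\<in>B. real_of_int (e b) *\<^sub>R b)"
    by (rule exI[of _ "\<lambda>b. k * c b"]) (simp add: scaleR_sum_right)
qed

lemma zspan_diff: "x \<in> zspan B \<Longrightarrow> y \<in> zspan B \<Longrightarrow> x - y \<in> zspan B"
  using zspan_add[of x B "- y"] zspan_scale[of y B "-1"] by simp

lemma zspan_sum: "(\<And>i. i \<in> I \<Longrightarrow> f i \<in> zspan B) \<Longrightarrow> (\<Sum>i\<in>I. f i) \<in> zspan B"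
  by (induction I rule: infinite_finite_induct) (auto simp: zspan_zero zspan_add)

lemma zspan_subset_span: "zspan B \<subseteq> span B"
  unfolding zspan_def by (auto intro!: span_sum span_scale intro: span_base)

lemma lattice_basis_zspan: "lattice_basis n B \<Longrightarrow> Zlattice n \<subseteq> zspan B"
  unfolding lattice_basis_def zspan_def by auto

text \<open>The coefficients of the unit vectors in a lattice basis are the coordinates of the dual
  lattice basis. The dual vectors are, up to sign, the edge directions at a vertex of a smooth polytope; they
  also turn independence over the integers into independence over the reals.\<close>

lemma lattice_basis_dual:
  assumes "lattice_basis n B"
  shows "\<exists>D. (\<forall>b\<in>B. D b \<in> Zlattice n) \<and>
    (\<forall>b\<in>B. \<forall>c\<in>B. pairing n b (D c) = (if b = c then 1 else 0))"
proof -
  have fin: "finite B" and BZ: "B \<subseteq> Zlattice n"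
    and ind: "\<And>c::(nat \<Rightarrow> real) \<Rightarrow> int. (\<Sum>b\<in>B. of_int (c b) *\<^sub>R b) = 0 \<Longrightarrow> (\<forall>b\<in>B. c b = 0)"
    using assms by (auto simp: lattice_basis_def)
  have "\<forall>k<n. \<exists>c::(nat \<Rightarrow> real) \<Rightarrow> int. unit_vector k = (\<Sum>b\<in>B. of_int (c b) *\<^sub>R b)"
    using assms unit_vector_Zlattice by (auto simp: lattice_basis_def)
  then obtain C :: "nat \<Rightarrow> (nat \<Rightarrow> real) \<Rightarrow> int"
    where C: "\<And>k. k < n \<Longrightarrow> unit_vector k = (\<Sum>b\<in>B. of_int (C k b) *\<^sub>R b)" by metis
  define D where "D c = (\<lambda>k. if k < n then real_of_int (C k c) else 0)" for c
  have DZ: "D c \<in> Zlattice n" for c by (auto simp: D_def Zlattice_iff Rspace_def)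
  have "pairing n b (D c) = (if b = c then 1 else 0)" if b: "b \<in> B" and c: "c \<in> B" for b c
  proof -
    define z where "z c = \<lfloor>pairing n b (D c)\<rfloor>" for c
    have z: "pairing n b (D c) = real_of_int (z c)" for c
      using pairing_Ints[of b n "D c"] BZ b DZ by (auto simp: z_def elim: Ints_cases)
    have "b = (\<Sum>k<n. b k *\<^sub>R unit_vector k)"
      using BZ b Rspace_expand Zlattice_imp_Rspace by blast
    also have "\<dots> = (\<Sum>k<n. \<Sum>c\<in>B. (b k * D c k) *\<^sub>R c)"
      by (rule sum.cong) (auto simp: C D_def scaleR_sum_right)
    also have "\<dots> = (\<Sum>c\<in>B. pairing n b (D c) *\<^sub>R c)"
      by (subst sum.swap) (simp add: pairing_def scaleR_sum_left)
    finally have b1: "b = (\<Sum>c\<in>B. of_int (z c) *\<^sub>R c)" by (simp add: z)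
    have b2: "b = (\<Sum>c\<in>B. of_int (if c = b then 1 else 0) *\<^sub>R c)"
    proof -
      have "b = (\<Sum>x\<in>B. if x = b then b else 0)" using fin b by simp
      also have "\<dots> = (\<Sum>c\<in>B. of_int (if c = b then 1 else 0) *\<^sub>R c)"
        by (rule sum.cong) auto
      finally show ?thesis .
    qed
    have "(\<Sum>c\<in>B. of_int (z c - (if c = b then 1 else 0)) *\<^sub>R c) =
        (\<Sum>c\<in>B. of_int (z c) *\<^sub>R c) - (\<Sum>c\<in>B. of_int (if c = b then 1 else 0) *\<^sub>R c)"
      by (simp only: of_int_diff scaleR_diff_left sum_subtractf)
    also have "\<dots> = 0"
      unfolding b1[symmetric] b2[symmetric] by simp
    finally have "(\<Sum>c\<in>B. of_int (z c - (if c = b then 1 else 0)) *\<^sub>R c) = 0" .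
    then have "\<forall>c\<in>B. z c - (if c = b then 1 else 0) = 0" by (intro ind)
    then show ?thesis using c z by auto
  qed
  then show ?thesis using DZ by (intro exI[of _ D]) simp
qed

lemma lattice_basis_span:
  assumes "lattice_basis n B" shows "span B = Rspace n"
proof
  show "span B \<subseteq> Rspace n"
    using assms span_Rspace_subset by (auto simp: lattice_basis_def Zlattice_def subset_iff)
  have "unit_vector ` {..<n} \<subseteq> span B"
    using lattice_basis_zspan[OF assms] zspan_subset_span unit_vector_Zlattice by blast
  then show "Rspace n \<subseteq> span B"
    using span_minimal[OF _ subspace_span] span_unit_vectors by blast
qed

lemma lattice_basis_independent:
  assumes "lattice_basis n B" shows "independent B"
proof -
  obtain D where D: "(\<forall>b\<in>B. D b \<in> Zlattice n) \<and>
      (\<forall>b\<in>B. \<forall>c\<in>B. pairing n b (D c) = (if b = c then 1 else 0))"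
    using lattice_basis_dual[OF assms] by (rule exE)
  have "finite B" using assms by (simp add: lattice_basis_def)
  then show ?thesis
    using biorthogonal_independent(2)[of B n "\<lambda>b. b" D] D by simp
qed

lemma lattice_basis_card:
  assumes "lattice_basis n B" shows "card B = n"
  using dim_eq_card[of B "Rspace n"] lattice_basis_span[OF assms] lattice_basis_independent[OF assms]
  by (simp add: dim_Rspace subspace_Rspace[THEN span_eq_iff[THEN iffD2]])

text \<open>A generating set with at most \<open>n\<close> elements spans an \<open>n\<close>-dimensional space, so it is
  independent.\<close>

lemma lattice_basisI_generating:
  assumes fin: "finite B" and BZ: "B \<subseteq> Zlattice n" and card: "card B \<le> n"
    and gen: "Zlattice n \<subseteq> zspan B"
  shows "lattice_basis n B"
proof -
  have "unit_vector ` {..<n} \<subseteq> span B"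
    using gen zspan_subset_span unit_vector_Zlattice by blast
  then have sp: "Rspace n \<subseteq> span B"
    using span_minimal[OF _ subspace_span] span_unit_vectors by blast
  obtain A where A: "A \<subseteq> B" "independent A" "B \<subseteq> span A" "card A = dim B"
    by (rule basis_exists)
  have BR: "B \<subseteq> Rspace n" using BZ Zlattice_imp_Rspace by auto
  have "dim B = n"
    using sp span_Rspace_subset[OF BR] span_eq_Rspace_iff_dim[OF BR] by auto
  then have "A = B" using A card fin by (metis card_seteq)
  then have ind: "independent B" using A by simp
  have "\<forall>b\<in>B. c b = 0" if "(\<Sum>b\<in>B. of_int (c b) *\<^sub>R b) = 0" for c :: "(nat \<Rightarrow> real) \<Rightarrow> int"
  proof -
    have "\<forall>u. (\<Sum>v\<in>B. u v *\<^sub>R v) = 0 \<longrightarrow> (\<forall>v\<in>B. u v = 0)"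
      using ind fin by (auto simp: dependent_finite)
    from this[rule_format, of "\<lambda>b. of_int (c b)", OF that] show ?thesis by simp
  qed
  then show ?thesis using fin BZ gen by (auto simp: lattice_basis_def zspan_def)
qed

section \<open>Polyhedra given by inequalities\<close>

text \<open>The inequalities are indexed rather than collected in a set, so that the support constants
  can be changed while the conormals stay the same, and so that the new inequalities constructed
  below can be labelled by the facet they come from.\<close>

definition hpoly :: "nat \<Rightarrow> 'i set \<Rightarrow> ('i \<Rightarrow> nat \<Rightarrow> real) \<Rightarrow> ('i \<Rightarrow> real) \<Rightarrow> (nat \<Rightarrow> real) set" where
  "hpoly n I a b = {x \<in> Rspace n. \<forall>i\<in>I. pairing n (a i) x \<le> b i}"

definition active :: "nat \<Rightarrow> 'i set \<Rightarrow> ('i \<Rightarrow> nat \<Rightarrow> real) \<Rightarrow> ('i \<Rightarrow> real) \<Rightarrow> (nat \<Rightarrow> real) \<Rightarrow> 'i set"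
  where "active n I a b x = {i \<in> I. pairing n (a i) x = b i}"

definition hface :: "nat \<Rightarrow> 'i set \<Rightarrow> ('i \<Rightarrow> nat \<Rightarrow> real) \<Rightarrow> ('i \<Rightarrow> real) \<Rightarrow> 'i set \<Rightarrow> (nat \<Rightarrow> real) set"
  where "hface n I a b T = {x \<in> hpoly n I a b. \<forall>i\<in>T. pairing n (a i) x = b i}"

lemma hpoly_subset_Rspace: "hpoly n I a b \<subseteq> Rspace n"
  by (auto simp: hpoly_def)

lemma hface_empty: "hface n I a b {} = hpoly n I a b"
  by (simp add: hface_def)

lemma convex_hpoly: "convex (hpoly n I a b)"
proof (rule convexI)
  fix x y :: "nat \<Rightarrow> real" and u v :: real
  assume *: "x \<in> hpoly n I a b" "y \<in> hpoly n I a b" "0 \<le> u" "0 \<le> v" "u + v = 1"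
  have "u * pairing n (a i) x + v * pairing n (a i) y \<le> b i" if "i \<in> I" for i
    using * that by (intro convex_bound_le) (auto simp: hpoly_def)
  then show "u *\<^sub>R x + v *\<^sub>R y \<in> hpoly n I a b"
    using * by (auto simp: hpoly_def pairing_linear Rspace_closed)
qed

text \<open>An affine function that is bounded above by its value at an interior point of a segment is
  constant on the segment.\<close>

lemma tight_at_both_ends:
  assumes x: "x \<in> open_segment u w" and uw: "u \<in> hpoly n I a b" "w \<in> hpoly n I a b"
    and i: "i \<in> I" and t: "pairing n (a i) x = b i"
  shows "pairing n (a i) u = b i" "pairing n (a i) w = b i"
proof -
  obtain s where s: "0 < s" "s < 1" "x = (1 - s) *\<^sub>R u + s *\<^sub>R w"
    using x by (auto simp: in_segment)
  have e: "(1 - s) * (b i - pairing n (a i) u) + s * (b i - pairing n (a i) w) = 0"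
    using t by (simp add: s(3) pairing_linear algebra_simps)
  have "0 \<le> b i - pairing n (a i) u" "0 \<le> b i - pairing n (a i) w"
    using uw i by (auto simp: hpoly_def)
  moreover from this have "0 \<le> (1 - s) * (b i - pairing n (a i) u)"
      "0 \<le> s * (b i - pairing n (a i) w)" using s by auto
  ultimately have "(1 - s) * (b i - pairing n (a i) u) = 0" "s * (b i - pairing n (a i) w) = 0"
    using e by linarith+
  then show "pairing n (a i) u = b i" "pairing n (a i) w = b i" using s by auto
qed

lemma hface_face_of:
  assumes "T \<subseteq> I" shows "hface n I a b T face_of hpoly n I a b"
  unfolding face_of_def
proof (intro conjI ballI impI)
  show "hface n I a b T \<subseteq> hpoly n I a b" by (auto simp: hface_def)
  show "convex (hface n I a b T)"
  proof (rule convexI)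
    fix x y :: "nat \<Rightarrow> real" and u v :: real
    assume *: "x \<in> hface n I a b T" "y \<in> hface n I a b T" "0 \<le> u" "0 \<le> v" "u + v = 1"
    have "u * b i + v * b i = b i" for i
      using * by (metis distrib_right mult_1)
    then show "u *\<^sub>R x + v *\<^sub>R y \<in> hface n I a b T"
      using * convexD[OF convex_hpoly, of x n I a b y u v]
      by (auto simp: hface_def pairing_linear)
  qed
next
  fix u w x assume "u \<in> hpoly n I a b" "w \<in> hpoly n I a b" "x \<in> hface n I a b T"
    "x \<in> open_segment u w"
  then show "u \<in> hface n I a b T" "w \<in> hface n I a b T"
    using tight_at_both_ends[of x u w n I a b] assms by (auto simp: hface_def subset_iff)
qed

text \<open>The inactive inequalities are strict and finite in number, so they survive, still strict,
  a small move in a direction along which no active one is violated.\<close>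

lemma small_step:
  assumes fin: "finite I" and x: "x \<in> hpoly n I a b" and d: "d \<in> Rspace n"
    and act: "\<And>i. i \<in> active n I a b x \<Longrightarrow> pairing n (a i) d \<le> 0"
  shows "\<exists>e>0. x + e *\<^sub>R d \<in> hpoly n I a b \<and>
    (\<forall>i \<in> I - active n I a b x. pairing n (a i) (x + e *\<^sub>R d) < b i)"
proof -
  define J where "J = I - active n I a b x"
  have "\<exists>e>0. \<forall>i\<in>J. pairing n (a i) (x + e *\<^sub>R d) < b i"
  proof -
    define f where "f i = (b i - pairing n (a i) x) / (1 + \<bar>pairing n (a i) d\<bar>)" for i
    define e where "e = Min (insert 1 (f ` J))"
    have finJ: "finite J" using fin by (simp add: J_def)
    have pos: "b i - pairing n (a i) x > 0" if "i \<in> J" for i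
      using that x by (force simp: J_def active_def hpoly_def)
    then have "f i > 0" if "i \<in> J" for i
      using that unfolding f_def by (intro divide_pos_pos) auto
    then have e: "e > 0" using finJ by (auto simp: e_def)
    moreover have "pairing n (a i) (x + e *\<^sub>R d) < b i" if "i \<in> J" for i
    proof -
      have "e \<le> f i" using that finJ by (auto simp: e_def)
      then have "e * (1 + \<bar>pairing n (a i) d\<bar>) \<le> b i - pairing n (a i) x"
        by (simp add: f_def pos_le_divide_eq add_pos_nonneg)
      moreover have "e * pairing n (a i) d \<le> e * \<bar>pairing n (a i) d\<bar>"
        using e by (intro mult_left_mono) auto
      moreover have "e * (1 + \<bar>pairing n (a i) d\<bar>) = e + e * \<bar>pairing n (a i) d\<bar>"
        by (simp add: distrib_left)
      ultimately show ?thesis using e unfolding pairing_linear by linarith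
    qed
    ultimately show ?thesis by blast
  qed
  then obtain e where e: "e > 0" "\<forall>i\<in>J. pairing n (a i) (x + e *\<^sub>R d) < b i" by blast
  have "pairing n (a i) (x + e *\<^sub>R d) \<le> b i" if "i \<in> I" for i
  proof (cases "i \<in> J")
    case False
    then have "i \<in> active n I a b x" using that by (auto simp: J_def)
    then have "pairing n (a i) x = b i" "e * pairing n (a i) d \<le> 0"
      using act e by (auto simp: active_def mult_nonneg_nonpos)
    then show ?thesis by (simp add: pairing_linear)
  qed (use e in auto)
  then have "x + e *\<^sub>R d \<in> hpoly n I a b"
    using x d by (auto simp: hpoly_def Rspace_closed)
  then show ?thesis using e by (auto simp: J_def)
qed

lemma in_open_segment_opposite:
  assumes "s > 0" "t > 0" "d \<noteq> 0"
  shows "x \<in> open_segment (x - s *\<^sub>R d) (x + t *\<^sub>R d)"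
  unfolding in_segment
proof (intro conjI exI[of _ "s / (s + t)"])
  have "x - s *\<^sub>R d \<noteq> x + t *\<^sub>R d"
  proof
    assume "x - s *\<^sub>R d = x + t *\<^sub>R d"
    then have "(s + t) *\<^sub>R d = 0" by (simp add: algebra_simps)
    then show False using assms by simp
  qed
  then show "x - s *\<^sub>R d \<noteq> x + t *\<^sub>R d" .
  have e: "(1 - s / (s + t)) = t / (s + t)" using assms by (simp add: field_simps)
  have "(1 - s / (s + t)) *\<^sub>R (x - s *\<^sub>R d) + (s / (s + t)) *\<^sub>R (x + t *\<^sub>R d) =
      (t / (s + t) + s / (s + t)) *\<^sub>R x + (s / (s + t) * t - t / (s + t) * s) *\<^sub>R d"
    unfolding e by (simp add: algebra_simps)
  also have "\<dots> = x"
    using assms by (simp add: add_divide_distrib[symmetric] add.commute[of t s])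
  finally show "x = (1 - s / (s + t)) *\<^sub>R (x - s *\<^sub>R d) + (s / (s + t)) *\<^sub>R (x + t *\<^sub>R d)" ..
qed (use assms in \<open>auto simp: field_simps\<close>)

text \<open>A direction that all active conormals annihilate can be followed a little both ways, and
  the two ends of a segment through \<open>x\<close> differ by such a direction.\<close>

lemma extreme_point_hpoly_iff:
  assumes fin: "finite I"
  shows "x extreme_point_of hpoly n I a b \<longleftrightarrow> x \<in> hpoly n I a b \<and>
    (\<forall>d\<in>Rspace n. (\<forall>i\<in>active n I a b x. pairing n (a i) d = 0) \<longrightarrow> d = 0)"
proof (intro iffI conjI ballI impI)
  assume x: "x extreme_point_of hpoly n I a b"
  then show xP: "x \<in> hpoly n I a b" by (simp add: extreme_point_of_def)
  fix d assume d: "d \<in> Rspace n" "\<forall>i\<in>active n I a b x. pairing n (a i) d = 0"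
  show "d = 0"
  proof (rule ccontr)
    assume "d \<noteq> 0"
    obtain t where t: "t > 0" "x + t *\<^sub>R d \<in> hpoly n I a b"
      using small_step[OF fin xP d(1)] d(2) by auto
    obtain s where s: "s > 0" "x + s *\<^sub>R (- d) \<in> hpoly n I a b"
      using small_step[OF fin xP Rspace_closed(5)[OF d(1)]] d(2) by (auto simp: pairing_minus_right)
    have "x \<in> open_segment (x - s *\<^sub>R d) (x + t *\<^sub>R d)"
      using in_open_segment_opposite s t \<open>d \<noteq> 0\<close> by blast
    then show False using x s t by (auto simp: extreme_point_of_def)
  qed
next
  assume x: "x \<in> hpoly n I a b \<and>
    (\<forall>d\<in>Rspace n. (\<forall>i\<in>active n I a b x. pairing n (a i) d = 0) \<longrightarrow> d = 0)"
  show "x extreme_point_of hpoly n I a b"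
    unfolding extreme_point_of_def
  proof (intro conjI ballI notI)
    fix u w assume uw: "u \<in> hpoly n I a b" "w \<in> hpoly n I a b" "x \<in> open_segment u w"
    have "pairing n (a i) (u - w) = 0" if "i \<in> active n I a b x" for i
      using tight_at_both_ends[OF uw(3,1,2)] that by (auto simp: active_def pairing_linear)
    moreover have "u - w \<in> Rspace n"
      using uw hpoly_subset_Rspace Rspace_closed(2) by blast
    ultimately have "u - w = 0" using x by blast
    then show False using uw(3) by (simp add: open_segment_def)
  qed (use x in auto)
qed

text \<open>A vertex is determined by its set of active inequalities.\<close>

lemma finite_extreme_points_hpoly:
  assumes fin: "finite I" shows "finite {v. v extreme_point_of hpoly n I a b}"
proof (rule inj_on_finite)
  show "inj_on (active n I a b) {v. v extreme_point_of hpoly n I a b}"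
  proof (rule inj_onI)
    fix v w assume v: "v \<in> {v. v extreme_point_of hpoly n I a b}"
      and w: "w \<in> {v. v extreme_point_of hpoly n I a b}"
      and eq: "active n I a b v = active n I a b w"
    have "pairing n (a i) (v - w) = 0" if "i \<in> active n I a b v" for i
      using that eq by (auto simp: active_def pairing_linear set_eq_iff)
    moreover have "v - w \<in> Rspace n"
      using v w hpoly_subset_Rspace Rspace_closed(2) by (fastforce simp: extreme_point_of_def)
    ultimately have "v - w = 0"
      using v unfolding mem_Collect_eq extreme_point_hpoly_iff[OF fin] by blast
    then show "v = w" by simp
  qed
  show "active n I a b ` {v. v extreme_point_of hpoly n I a b} \<subseteq> Pow I"
    by (auto simp: active_def)
  show "finite (Pow I)" using fin by simp
qed

text \<open>The step length is the least ratio of slack to growth among the inequalities that tighten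
  along \<open>d\<close>.\<close>

lemma step_to_new_constraint:
  assumes fin: "finite I" and x: "x \<in> hpoly n I a b" and d: "d \<in> Rspace n"
    and act: "\<And>i. i \<in> active n I a b x \<Longrightarrow> pairing n (a i) d = 0"
    and out: "i0 \<in> I" "pairing n (a i0) d > 0"
  shows "\<exists>t>0. x + t *\<^sub>R d \<in> hpoly n I a b \<and>
    active n I a b x \<subset> active n I a b (x + t *\<^sub>R d)"
proof -
  define J where "J = {i \<in> I. pairing n (a i) d > 0}"
  define f where "f i = (b i - pairing n (a i) x) / pairing n (a i) d" for i
  define t where "t = Min (f ` J)"
  have finJ: "finite J" "J \<noteq> {}" using fin out by (auto simp: J_def)
  have "t \<in> f ` J" using finJ by (auto simp: t_def)
  then obtain j where j: "j \<in> J" "t = f j" by auto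
  have tle: "t \<le> f i" if "i \<in> J" for i using that finJ by (auto simp: t_def)
  have jn: "j \<notin> active n I a b x" using j act by (force simp: J_def)
  then have "b j - pairing n (a j) x > 0" using j x by (force simp: J_def active_def hpoly_def)
  then have t0: "t > 0" using j by (simp add: f_def J_def)
  have "pairing n (a i) x + t * pairing n (a i) d \<le> b i" if "i \<in> I" for i
  proof (cases "i \<in> J")
    case True
    then show ?thesis using tle[OF True] by (simp add: f_def J_def field_simps)
  next
    case False
    then have "t * pairing n (a i) d \<le> 0" using that t0 by (simp add: J_def mult_nonneg_nonpos)
    then show ?thesis using x that by (force simp: hpoly_def)
  qed
  then have P: "x + t *\<^sub>R d \<in> hpoly n I a b"
    using x d by (auto simp: hpoly_def Rspace_closed pairing_linear)
  have "active n I a b x \<subseteq> active n I a b (x + t *\<^sub>R d)"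
    using act by (auto simp: active_def pairing_linear)
  moreover have "j \<in> active n I a b (x + t *\<^sub>R d)"
    using j by (auto simp: active_def J_def f_def pairing_linear)
  ultimately show ?thesis using t0 P jn by blast
qed

text \<open>A point that is not extreme lies between two points with more active inequalities: move in
  a direction that the active conormals annihilate, both ways, until a new inequality becomes
  active, which happens because there is no recession direction. Keeping track of the active
  sets shows that every nonempty face contains a vertex.\<close>

lemma in_hull_of_extreme_points:
  assumes fin: "finite I"
    and bounded: "\<forall>d\<in>Rspace n. (\<forall>i\<in>I. pairing n (a i) d \<le> 0) \<longrightarrow> d = 0"
    and x: "x \<in> hpoly n I a b"
  shows "x \<in> convex hull {v. v extreme_point_of hpoly n I a b \<and> active n I a b x \<subseteq> active n I a b v}"
  using x
proof (induction "card (I - active n I a b x)" arbitrary: x rule: less_induct)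
  case less
  let ?V = "\<lambda>x. {v. v extreme_point_of hpoly n I a b \<and> active n I a b x \<subseteq> active n I a b v}"
  show ?case
  proof (cases "x extreme_point_of hpoly n I a b")
    case True
    then show ?thesis by (intro hull_inc) simp
  next
    case False
    then obtain d where d: "d \<in> Rspace n" "\<And>i. i \<in> active n I a b x \<Longrightarrow> pairing n (a i) d = 0" "d \<noteq> 0"
      using less.prems by (auto simp: extreme_point_hpoly_iff[OF fin])
    have md: "- d \<in> Rspace n" using d Rspace_closed(5) by blast
    have step: "y \<in> convex hull ?V x"
      if y: "y \<in> hpoly n I a b" "active n I a b x \<subset> active n I a b y" for y
    proof -
      have "active n I a b y \<subseteq> I" by (auto simp: active_def)
      then have "card (I - active n I a b y) < card (I - active n I a b x)"
        using y fin by (intro psubset_card_mono) auto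
      then have "y \<in> convex hull ?V y" using less.hyps y by blast
      moreover have "?V y \<subseteq> ?V x" using y by auto
      ultimately show ?thesis using hull_mono by blast
    qed
    obtain i where i: "i \<in> I" "pairing n (a i) d > 0"
      using bounded d(1,3) by force
    obtain i' where i': "i' \<in> I" "pairing n (a i') (- d) > 0"
      using bounded md d(3) by force
    obtain t where t: "t > 0" "x + t *\<^sub>R d \<in> hpoly n I a b"
      "active n I a b x \<subset> active n I a b (x + t *\<^sub>R d)"
      using step_to_new_constraint[OF fin less.prems d(1,2) i] by blast
    have d2: "pairing n (a i) (- d) = 0" if "i \<in> active n I a b x" for i
      using d(2) that by (simp add: pairing_minus_right)
    obtain s where s: "s > 0" "x + s *\<^sub>R (- d) \<in> hpoly n I a b"
      "active n I a b x \<subset> active n I a b (x + s *\<^sub>R (- d))"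
      using step_to_new_constraint[OF fin less.prems md d2 i'] by blast
    have "x \<in> closed_segment (x - s *\<^sub>R d) (x + t *\<^sub>R d)"
      using in_open_segment_opposite[OF s(1) t(1) d(3)] segment_open_subset_closed by blast
    moreover have "x - s *\<^sub>R d \<in> convex hull ?V x" "x + t *\<^sub>R d \<in> convex hull ?V x"
      using step[OF t(2,3)] step[OF s(2,3)] by auto
    ultimately show ?thesis
      using convex_contains_segment convex_convex_hull by blast
  qed
qed

text \<open>A point \<open>x\<close> of the face with fewest active inequalities satisfies only those equations
  that hold on the whole face. From any \<open>y\<close> that satisfies these equations the segment through
  \<open>x\<close> can be continued beyond \<open>x\<close>, so the face contains \<open>y\<close>.\<close>

lemma face_of_hpoly:
  assumes fin: "finite I" and F: "F face_of hpoly n I a b" and ne: "F \<noteq> {}"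
  obtains x where "x \<in> F" "F = hface n I a b (active n I a b x)"
proof -
  have FP: "F \<subseteq> hpoly n I a b" using F face_of_imp_subset by blast
  have "\<exists>x. x \<in> F \<and> (\<forall>y. y \<in> F \<longrightarrow> card (active n I a b x) \<le> card (active n I a b y))"
    using ne ex_has_least_nat[of "\<lambda>x. x \<in> F" _ "\<lambda>x. card (active n I a b x)"] by blast
  then obtain x where x: "x \<in> F"
    and least: "\<And>y. y \<in> F \<Longrightarrow> card (active n I a b x) \<le> card (active n I a b y)" by blast
  have "active n I a b x \<subseteq> active n I a b y" if y: "y \<in> F" for y
  proof (cases "x = y")
    case False
    define m where "m = (1/2) *\<^sub>R x + (1/2) *\<^sub>R y"
    have mF: "m \<in> F"
      unfolding m_def using convexD[OF face_of_imp_convex[OF F] x y, of "1/2" "1/2"] by simp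
    have seg: "m \<in> open_segment x y"
      using False unfolding in_segment m_def by (intro conjI exI[of _ "1/2"]) auto
    have "active n I a b m \<subseteq> active n I a b x \<inter> active n I a b y"
      using tight_at_both_ends[OF seg, of n I a b] x y FP by (auto simp: active_def)
    moreover have "finite (active n I a b x)" using fin by (simp add: active_def)
    ultimately have "active n I a b m = active n I a b x"
      using least[OF mF] by (meson card_seteq Int_subset_iff)
    then show ?thesis
      using \<open>active n I a b m \<subseteq> active n I a b x \<inter> active n I a b y\<close> by blast
  qed simp
  then have "F \<subseteq> hface n I a b (active n I a b x)"
    using FP by (auto simp: hface_def active_def)
  moreover have "y \<in> F" if y: "y \<in> hface n I a b (active n I a b x)" for y
  proof (cases "x = y")
    case False
    have yP: "y \<in> hpoly n I a b" and xP: "x \<in> hpoly n I a b"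
      using y x FP by (auto simp: hface_def)
    have d: "x - y \<in> Rspace n" using yP xP hpoly_subset_Rspace Rspace_closed(2) by blast
    have "pairing n (a i) (x - y) \<le> 0" if "i \<in> active n I a b x" for i
      using y that by (auto simp: hface_def active_def pairing_linear)
    then obtain e where e: "e > 0" "x + e *\<^sub>R (x - y) \<in> hpoly n I a b"
      using small_step[OF fin xP d] by blast
    have "x \<in> open_segment y (x + e *\<^sub>R (x - y))"
      using in_open_segment_opposite[of 1 e "x - y" x] e False by simp
    then show ?thesis using face_ofD[OF F _ yP e(2) x] by blast
  qed (use x in simp)
  ultimately show ?thesis using that x by blast
qed

text \<open>Since \<open>x\<close> is a relative interior point of the face, every direction annihilated by the
  active conormals is a multiple of a difference of two points of the face.\<close>

lemma affine_dim_hface: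
  assumes fin: "finite I" and x: "x \<in> hpoly n I a b"
  shows "affine_dim (hface n I a b (active n I a b x)) =
    dim {d \<in> Rspace n. \<forall>i\<in>active n I a b x. pairing n (a i) d = 0}"
  (is "affine_dim ?F = dim ?A")
proof -
  have "{u - w |u w. u \<in> ?F \<and> w \<in> ?F} \<subseteq> ?A"
    using hpoly_subset_Rspace[of n I a b]
    by (auto simp: hface_def active_def pairing_linear intro!: Rspace_closed(2))
  moreover have "?A \<subseteq> span {u - w |u w. u \<in> ?F \<and> w \<in> ?F}"
  proof
    fix d assume d: "d \<in> ?A"
    then obtain e where e: "e > 0" "x + e *\<^sub>R d \<in> hpoly n I a b"
      using small_step[OF fin x, of d] by auto
    have "x + e *\<^sub>R d \<in> ?F" "x \<in> ?F"
      using d e x by (auto simp: hface_def active_def pairing_linear)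
    then have "(x + e *\<^sub>R d) - x \<in> {u - w |u w. u \<in> ?F \<and> w \<in> ?F}" by blast
    then have "(1 / e) *\<^sub>R ((x + e *\<^sub>R d) - x) \<in> span {u - w |u w. u \<in> ?F \<and> w \<in> ?F}"
      by (intro span_scale span_base)
    then show "d \<in> span {u - w |u w. u \<in> ?F \<and> w \<in> ?F}" using e by simp
  qed
  ultimately show ?thesis
    unfolding affine_dim_def by (meson span_eq_dim span_mono span_minimal subspace_span subset_antisym)
qed

section \<open>Presentations of smooth polytopes\<close>

text \<open>Boundedness is expressed by the absence of recession directions. The assumption \<open>attained\<close>
  excludes inequalities that do not touch the polytope; together with the conditions at the
  vertices it makes the inequalities correspond to the facets one to one.\<close>

locale smooth_presentation =
  fixes n :: nat and I :: "'i set" and a :: "'i \<Rightarrow> nat \<Rightarrow> real" and b :: "'i \<Rightarrow> real"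
  assumes finite_index: "finite I"
    and no_recession: "\<forall>d\<in>Rspace n. (\<forall>i\<in>I. pairing n (a i) d \<le> 0) \<longrightarrow> d = 0"
    and attained: "\<And>i. i \<in> I \<Longrightarrow> \<exists>x\<in>hpoly n I a b. pairing n (a i) x = b i"
    and inj_at_vertex: "\<And>v. v extreme_point_of hpoly n I a b \<Longrightarrow> inj_on a (active n I a b v)"
    and basis_at_vertex:
      "\<And>v. v extreme_point_of hpoly n I a b \<Longrightarrow> lattice_basis n (a ` active n I a b v)"
begin

abbreviation "P \<equiv> hpoly n I a b"
abbreviation "act \<equiv> active n I a b"
abbreviation "hf \<equiv> hface n I a b"

lemma act_subset: "act x \<subseteq> I" by (auto simp: active_def)

lemma finite_act: "finite (act x)" using act_subset finite_index finite_subset by blast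

lemma vertex_beyond:
  assumes "x \<in> P"
  obtains v where "v extreme_point_of P" "act x \<subseteq> act v"
proof -
  have "{v. v extreme_point_of P \<and> act x \<subseteq> act v} \<noteq> {}"
    using in_hull_of_extreme_points[OF finite_index no_recession assms] by fastforce
  then show ?thesis using that by blast
qed

lemma hpoly_eq_hull: "P = convex hull {v. v extreme_point_of P}"
proof
  show "P \<subseteq> convex hull {v. v extreme_point_of P}"
  proof
    fix x assume "x \<in> P"
    from in_hull_of_extreme_points[OF finite_index no_recession this]
    show "x \<in> convex hull {v. v extreme_point_of P}"
      using hull_mono[of "{v. v extreme_point_of P \<and> act x \<subseteq> act v}" "{v. v extreme_point_of P}"]
      by blast
  qed
  show "convex hull {v. v extreme_point_of P} \<subseteq> P"
    by (intro hull_minimal convex_hpoly) (auto simp: extreme_point_of_def)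
qed

lemma polytope_hpoly: "polytope P"
  unfolding polytope_def using hpoly_eq_hull finite_extreme_points_hpoly[OF finite_index] by blast

lemma hpoly_nonempty: "P \<noteq> {}"
proof (cases "I = {}")
  case True
  then have "0 \<in> P" by (simp add: hpoly_def Rspace_closed)
  then show ?thesis by blast
qed (use attained in blast)

lemma vertex_iff:
  "v extreme_point_of P \<longleftrightarrow> v \<in> P \<and> (\<forall>d\<in>Rspace n. (\<forall>i\<in>act v. pairing n (a i) d = 0) \<longrightarrow> d = 0)"
  by (rule extreme_point_hpoly_iff[OF finite_index])

lemma card_act_vertex: "v extreme_point_of P \<Longrightarrow> card (act v) = n"
  using lattice_basis_card[OF basis_at_vertex, of v] card_image[OF inj_at_vertex, of v] by (simp only: card_image)

lemma conormal_Zlattice: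
  assumes "i \<in> I" shows "a i \<in> Zlattice n"
proof -
  obtain x where "x \<in> P" "i \<in> act x" using attained[OF assms] assms by (auto simp: active_def)
  then obtain v where "v extreme_point_of P" "i \<in> act v" using vertex_beyond by blast
  then show ?thesis using basis_at_vertex by (fastforce simp: lattice_basis_def)
qed

text \<open>These are the primitive vectors along the edges at \<open>v\<close>, up to sign.\<close>

lemma edge_directions:
  assumes v: "v extreme_point_of P"
  shows "\<exists>D. (\<forall>i\<in>act v. D i \<in> Zlattice n) \<and>
    (\<forall>i\<in>act v. \<forall>j\<in>act v. pairing n (a i) (D j) = (if i = j then 1 else 0))"
proof -
  obtain D where D: "(\<forall>c\<in>a ` act v. D c \<in> Zlattice n) \<and>
      (\<forall>c\<in>a ` act v. \<forall>c'\<in>a ` act v. pairing n c (D c') = (if c = c' then 1 else 0))"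
    using lattice_basis_dual[OF basis_at_vertex[OF v]] by (rule exE)
  then show ?thesis
    using inj_on_eq_iff[OF inj_at_vertex[OF v]] by (intro exI[of _ "D \<circ> a"]) simp
qed

text \<open>From the vertex, move a little along the sum of the directions of the edges on which some
  \<open>i \<in> act v - T\<close> becomes inactive.\<close>

lemma point_with_active_set:
  assumes v: "v extreme_point_of P" and T: "T \<subseteq> act v"
  obtains x where "x \<in> P" "act x = T"
proof -
  obtain D where "(\<forall>i\<in>act v. D i \<in> Zlattice n) \<and>
      (\<forall>i\<in>act v. \<forall>j\<in>act v. pairing n (a i) (D j) = (if i = j then 1 else 0))"
    using edge_directions[OF v] by (rule exE)
  note D = conjunct1[OF this, rule_format] conjunct2[OF this, rule_format]
  define d where "d = - (\<Sum>j\<in>act v - T. D j)"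
  have dR: "d \<in> Rspace n"
    unfolding d_def using D Zlattice_imp_Rspace by (intro Rspace_closed) auto
  have ad: "pairing n (a i) d = (if i \<in> T then 0 else - 1)" if i: "i \<in> act v" for i
  proof -
    have "pairing n (a i) d = - (\<Sum>j\<in>act v - T. if i = j then 1 else 0)"
      unfolding d_def pairing_minus_right pairing_sum_right using D(2) i
      by (intro arg_cong[where f = uminus] sum.cong) auto
    then show ?thesis using i finite_act by simp
  qed
  have vP: "v \<in> P" using v by (simp add: extreme_point_of_def)
  obtain e where e: "e > 0" "v + e *\<^sub>R d \<in> P"
    "\<forall>i\<in>I - act v. pairing n (a i) (v + e *\<^sub>R d) < b i"
    using small_step[OF finite_index vP dR] ad by fastforce
  have "act (v + e *\<^sub>R d) = T"
  proof (rule set_eqI)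
    fix i show "i \<in> act (v + e *\<^sub>R d) \<longleftrightarrow> i \<in> T"
    proof (cases "i \<in> act v")
      case True
      then have "pairing n (a i) (v + e *\<^sub>R d) = b i + e * (if i \<in> T then 0 else - 1)"
        by (simp add: pairing_add_right pairing_scaleR_right ad) (simp add: active_def)
      then show ?thesis using True e(1) by (auto simp: active_def)
    next
      case False
      then have "i \<notin> act (v + e *\<^sub>R d)" using bspec[OF e(3), of i] by (auto simp: active_def)
      then show ?thesis using False T by blast
    qed
  qed
  then show ?thesis using that e by blast
qed

text \<open>The edge directions that belong to \<open>act v - T\<close> form a basis of this space.\<close>

lemma dim_annihilator:
  assumes v: "v extreme_point_of P" and T: "T \<subseteq> act v"
  shows "dim {d \<in> Rspace n. \<forall>i\<in>T. pairing n (a i) d = 0} + card T = n"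
proof -
  obtain D where "(\<forall>i\<in>act v. D i \<in> Zlattice n) \<and>
      (\<forall>i\<in>act v. \<forall>j\<in>act v. pairing n (a i) (D j) = (if i = j then 1 else 0))"
    using edge_directions[OF v] by (rule exE)
  note D = conjunct1[OF this, rule_format] conjunct2[OF this, rule_format]
  let ?J = "act v - T" and ?A = "{d \<in> Rspace n. \<forall>i\<in>T. pairing n (a i) d = 0}"
  have DR: "D i \<in> Rspace n" if "i \<in> act v" for i using D that Zlattice_imp_Rspace by blast
  have "pairing n (D i) (a j) = (if i = j then 1 else 0)" if "i \<in> ?J" "j \<in> ?J" for i j
    using D(2)[of j i] that by (auto simp: pairing_commute)
  then have ind: "inj_on D ?J" "independent (D ` ?J)"
    using biorthogonal_independent[of ?J n D a] finite_act by auto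
  have sub: "D ` ?J \<subseteq> ?A" using DR D(2) T by force
  have sp: "?A \<subseteq> span (D ` ?J)"
  proof
    fix d assume d: "d \<in> ?A"
    define y where "y = (\<Sum>j\<in>?J. pairing n (a j) d *\<^sub>R D j)"
    have yR: "y \<in> Rspace n" unfolding y_def using DR by (intro Rspace_closed) auto
    have "pairing n (a i) (d - y) = 0" if i: "i \<in> act v" for i
    proof -
      have "pairing n (a i) y = (\<Sum>j\<in>?J. if i = j then pairing n (a j) d else 0)"
        unfolding y_def pairing_sum_right pairing_scaleR_right
        using D(2) i by (intro sum.cong) auto
      also have "\<dots> = pairing n (a i) d" using d i finite_act by auto
      finally show ?thesis by (simp add: pairing_diff_right)
    qed
    moreover have "d - y \<in> Rspace n" using d yR Rspace_closed(2) by blast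
    ultimately have "d - y = 0" using v unfolding vertex_iff by blast
    moreover have "y \<in> span (D ` ?J)"
      unfolding y_def by (auto intro!: span_sum span_scale intro: span_base)
    ultimately show "d \<in> span (D ` ?J)" by simp
  qed
  have "dim ?A = card (D ` ?J)" using sub sp ind by (intro dim_unique) auto
  also have "\<dots> = card (act v) - card T"
    using ind T finite_act by (simp add: card_image card_Diff_subset finite_subset[OF T])
  finally show ?thesis
    using card_act_vertex[OF v] card_mono[OF finite_act T] by simp
qed

lemma affine_dim_hf:
  assumes v: "v extreme_point_of P" and T: "T \<subseteq> act v"
  shows "affine_dim (hf T) + card T = n"
proof -
  obtain x where x: "x \<in> P" "act x = T" using point_with_active_set[OF v T] .
  show ?thesis
    using affine_dim_hface[OF finite_index x(1)] dim_annihilator[OF v T] unfolding x(2) by simp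
qed

lemma affine_dim_P: "affine_dim P = n"
proof -
  obtain x where "x \<in> P" using hpoly_nonempty by blast
  then obtain v where v: "v extreme_point_of P" "act x \<subseteq> act v" by (rule vertex_beyond)
  from affine_dim_hf[OF v(1), of "{}"] show ?thesis by (simp add: hface_empty)
qed

lemma vertex_on_facet:
  assumes "i \<in> I" obtains v where "v extreme_point_of P" "i \<in> act v"
proof -
  obtain x where "x \<in> P" "i \<in> act x" using attained[OF assms] assms by (auto simp: active_def)
  then show ?thesis using vertex_beyond that by blast
qed

lemma point_inside_facet:
  assumes "i \<in> I" obtains x where "x \<in> P" "act x = {i}"
proof -
  obtain v where "v extreme_point_of P" "i \<in> act v" using vertex_on_facet[OF assms] .
  then show ?thesis using point_with_active_set[of v "{i}"] that by blast
qed

text \<open>A facet is cut out by the set of inequalities active at one of its points; they are active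
  at a vertex, where each active inequality lowers the dimension by one, so there is exactly one
  of them.\<close>

lemma is_facet_iff: "is_facet P F \<longleftrightarrow> (\<exists>i\<in>I. F = hf {i})"
proof
  assume F: "is_facet P F"
  then obtain x where x: "x \<in> F" "F = hf (act x)"
    using face_of_hpoly[OF finite_index, of F n a b] by (auto simp: is_facet_def)
  have "x \<in> P" using x by (auto simp: hface_def)
  then obtain v where v: "v extreme_point_of P" "act x \<subseteq> act v" using vertex_beyond by blast
  have "card (act x) = 1"
    using affine_dim_hf[OF v] F x(2) by (simp add: is_facet_def affine_dim_P)
  then obtain i where "act x = {i}" using card_1_singletonE by blast
  moreover from this have "i \<in> I" using act_subset by blast
  ultimately show "\<exists>i\<in>I. F = hf {i}" using x by auto
next
  assume "\<exists>i\<in>I. F = hf {i}"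
  then obtain i where i: "i \<in> I" "F = hf {i}" by blast
  obtain v where v: "v extreme_point_of P" "i \<in> act v" using vertex_on_facet[OF i(1)] .
  have "hf {i} \<noteq> {}" using attained[OF i(1)] by (auto simp: hface_def)
  moreover have "affine_dim (hf {i}) + 1 = n" using affine_dim_hf[OF v(1), of "{i}"] v(2) by simp
  ultimately show "is_facet P F"
    using hface_face_of[of "{i}" I n a b] i by (simp add: is_facet_def affine_dim_P)
qed

lemma in_hf_iff: "x \<in> P \<Longrightarrow> i \<in> I \<Longrightarrow> x \<in> hf {i} \<longleftrightarrow> i \<in> act x"
  by (auto simp: hface_def active_def)

lemma facet_index_inj:
  assumes "i \<in> I" "j \<in> I" "hf {i} = hf {j}" shows "i = j"
proof -
  obtain x where x: "x \<in> P" "act x = {i}" using point_inside_facet[OF assms(1)] .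
  have "x \<in> hf {i}" unfolding in_hf_iff[OF x(1) assms(1)] x(2) by simp
  then have "j \<in> act x" unfolding assms(3) in_hf_iff[OF x(1) assms(2)] .
  then show ?thesis by (simp add: x(2))
qed

lemma primitive_conormal:
  assumes "i \<in> I" shows "primitive_vector n (a i)"
proof -
  obtain v where v: "v extreme_point_of P" "i \<in> act v" using vertex_on_facet[OF assms] .
  obtain D where "(\<forall>i\<in>act v. D i \<in> Zlattice n) \<and>
      (\<forall>i\<in>act v. \<forall>j\<in>act v. pairing n (a i) (D j) = (if i = j then 1 else 0))"
    using edge_directions[OF v(1)] by (rule exE)
  note D = conjunct1[OF this, rule_format] conjunct2[OF this, rule_format]
  note D = D(1)[OF v(2)] D(2)[OF v(2) v(2), unfolded if_P[OF refl]]
  show ?thesis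
    unfolding primitive_vector_def
  proof (intro conjI allI ballI impI)
    show "a i \<in> Zlattice n" using conormal_Zlattice[OF assms] .
    fix k :: int and z assume z: "z \<in> Zlattice n" "a i = of_int k *\<^sub>R z"
    obtain m where "pairing n z (D i) = of_int m"
      using pairing_Ints[OF z(1) D(1)] Ints_cases by blast
    then have "of_int (k * m) = (1::real)" using D(2) z(2) by (simp add: pairing_scaleR_left)
    then have "k * m = 1" by (simp only: of_int_eq_1_iff)
    then show "\<bar>k\<bar> = 1" using zmult_eq_1_iff[of k m] by auto
  qed
qed

text \<open>A conormal of the facet is an integral functional that vanishes on the kernel of \<open>a i\<close>,
  hence an integer multiple \<open>k\<close> of \<open>a i\<close>, the integer being its value on the dual vector.
  Primitivity gives \<open>\<bar>k\<bar> = 1\<close>, and a point off the facet fixes the sign.\<close>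

lemma outward_conormal_iff:
  assumes i: "i \<in> I" shows "outward_conormal n P (hf {i}) \<eta> \<longleftrightarrow> \<eta> = a i"
proof
  assume "\<eta> = a i"
  then show "outward_conormal n P (hf {i}) \<eta>"
    unfolding outward_conormal_def
    using primitive_conormal[OF i] i
    by (auto simp: hface_def hpoly_def intro!: exI[of _ "b i"])
next
  assume oc: "outward_conormal n P (hf {i}) \<eta>"
  then obtain \<kappa> where pr: "primitive_vector n \<eta>"
    and le: "\<And>x. x \<in> P \<Longrightarrow> pairing n \<eta> x \<le> \<kappa>" and F: "hf {i} = {x \<in> P. pairing n \<eta> x = \<kappa>}"
    by (auto simp: outward_conormal_def)
  have \<eta>Z: "\<eta> \<in> Zlattice n" using pr by (simp add: primitive_vector_def)
  obtain v where v: "v extreme_point_of P" "i \<in> act v" using vertex_on_facet[OF i] .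
  obtain D where "(\<forall>i\<in>act v. D i \<in> Zlattice n) \<and>
      (\<forall>i\<in>act v. \<forall>j\<in>act v. pairing n (a i) (D j) = (if i = j then 1 else 0))"
    using edge_directions[OF v(1)] by (rule exE)
  note D = conjunct1[OF this, rule_format] conjunct2[OF this, rule_format]
  obtain x where x: "x \<in> P" "act x = {i}" using point_inside_facet[OF i] .
  have ortho: "pairing n \<eta> d = 0" if d: "d \<in> Rspace n" "pairing n (a i) d = 0" for d
  proof -
    obtain e where e: "e > 0" "x + e *\<^sub>R d \<in> P"
      using small_step[OF finite_index x(1) d(1)] x(2) d(2) by auto
    have "x \<in> hf {i}" using in_hf_iff x i by auto
    moreover have "x + e *\<^sub>R d \<in> hf {i}"
      using e d \<open>x \<in> hf {i}\<close> by (simp add: hface_def pairing_add_right pairing_scaleR_right)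
    ultimately have "pairing n \<eta> (x + e *\<^sub>R d) = pairing n \<eta> x" using F by auto
    then show ?thesis using e by (simp add: pairing_add_right pairing_scaleR_right)
  qed
  define k where "k = \<lfloor>pairing n \<eta> (D i)\<rfloor>"
  have k: "pairing n \<eta> (D i) = of_int k"
    using pairing_Ints[OF \<eta>Z D(1)[OF v(2)]] by (auto simp: k_def elim: Ints_cases)
  have aR: "a i \<in> Rspace n" using conormal_Zlattice i Zlattice_imp_Rspace by blast
  have \<eta>k: "\<eta> = of_int k *\<^sub>R a i"
  proof -
    have "pairing n (\<eta> - of_int k *\<^sub>R a i) y = 0" if y: "y \<in> Rspace n" for y
    proof -
      have DR: "D i \<in> Rspace n" using D(1)[OF v(2)] Zlattice_imp_Rspace by blast
      have "pairing n \<eta> (y - pairing n (a i) y *\<^sub>R D i) = 0"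
        using y DR D(2)[OF v(2) v(2)]
        by (intro ortho Rspace_closed) (auto simp: pairing_diff_right pairing_scaleR_right)
      then show ?thesis
        by (simp add: k pairing_diff_right pairing_scaleR_right pairing_diff_left pairing_scaleR_left)
    qed
    moreover have "\<eta> - of_int k *\<^sub>R a i \<in> Rspace n"
      using \<eta>Z aR Zlattice_imp_Rspace by (intro Rspace_closed) auto
    ultimately have "\<eta> - of_int k *\<^sub>R a i = 0" by (intro pairing_eq_0_imp_zero) auto
    then show ?thesis by simp
  qed
  have "\<bar>k\<bar> = 1" using pr \<eta>k conormal_Zlattice[OF i] by (auto simp: primitive_vector_def)
  moreover have "k \<noteq> -1"
  proof
    assume "k = -1"
    obtain y where y: "y \<in> P" "act y = {}" using point_with_active_set[OF v(1), of "{}"] by auto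
    have "pairing n (a i) y < b i" using y i by (force simp: hpoly_def active_def)
    moreover have "pairing n \<eta> y \<le> \<kappa>" using le y by blast
    moreover have "pairing n \<eta> x = \<kappa>" using F in_hf_iff[OF x(1) i] x by auto
    moreover have "pairing n (a i) x = b i" using x by (auto simp: active_def)
    ultimately show False using \<eta>k \<open>k = -1\<close> by (simp add: pairing_minus_left)
  qed
  ultimately have "k = 1" by linarith
  then show "\<eta> = a i" using \<eta>k by simp
qed

lemma smooth_polytope_hpoly: "smooth_polytope n P"
  unfolding smooth_polytope_def
proof (intro conjI allI impI)
  show "polytope P" "P \<subseteq> Rspace n" "P \<noteq> {}" "affine_dim P = n"
    by (rule polytope_hpoly hpoly_subset_Rspace hpoly_nonempty affine_dim_P)+
next
  fix v assume v: "v extreme_point_of P"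
  then have vP: "v \<in> P" by (simp add: extreme_point_of_def)
  have facets: "is_facet P F \<and> v \<in> F \<longleftrightarrow> (\<exists>i\<in>act v. F = hf {i})" for F
  proof
    assume "is_facet P F \<and> v \<in> F"
    then obtain i where i: "i \<in> I" "F = hf {i}" "v \<in> F" using is_facet_iff[of F] by blast
    then have "i \<in> act v" using in_hf_iff[OF vP i(1)] by simp
    then show "\<exists>i\<in>act v. F = hf {i}" using i(2) by (rule bexI[rotated])
  next
    assume "\<exists>i\<in>act v. F = hf {i}"
    then obtain i where i: "i \<in> act v" "F = hf {i}" by (rule bexE)
    have iI: "i \<in> I" using act_subset i(1) by (rule subsetD)
    have "is_facet P F" unfolding is_facet_iff using i(2) iI by (rule bexI)
    moreover have "v \<in> F" using in_hf_iff[OF vP iI] i by simp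
    ultimately show "is_facet P F \<and> v \<in> F" by (rule conjI)
  qed
  then have "{F. is_facet P F \<and> v \<in> F} = (\<lambda>i. hf {i}) ` act v"
    by (simp only: image_def)
  moreover have "inj_on (\<lambda>i. hf {i}) (act v)"
    by (rule inj_onI) (rule facet_index_inj; use act_subset in blast)
  ultimately show "card {F. is_facet P F \<and> v \<in> F} = n"
    using card_act_vertex[OF v] by (simp only: card_image)
  have "(\<exists>F. is_facet P F \<and> v \<in> F \<and> outward_conormal n P F \<eta>) \<longleftrightarrow> (\<exists>i\<in>act v. \<eta> = a i)" for \<eta>
  proof -
    have "(\<exists>F. is_facet P F \<and> v \<in> F \<and> outward_conormal n P F \<eta>) \<longleftrightarrow>
        (\<exists>i\<in>act v. outward_conormal n P (hf {i}) \<eta>)"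
      unfolding conj_assoc[symmetric] facets by blast
    also have "\<dots> \<longleftrightarrow> (\<exists>i\<in>act v. \<eta> = a i)"
      by (rule bex_cong[OF refl], rule outward_conormal_iff) (use act_subset in blast)
    finally show ?thesis .
  qed
  then have "{\<eta>. \<exists>F. is_facet P F \<and> v \<in> F \<and> outward_conormal n P F \<eta>} = a ` act v"
    by (simp only: image_def)
  then show "lattice_basis n {\<eta>. \<exists>F. is_facet P F \<and> v \<in> F \<and> outward_conormal n P F \<eta>}"
    using basis_at_vertex[OF v] by (simp only:)
next
  fix F assume "is_facet P F"
  then obtain i where "i \<in> I" "F = hf {i}" unfolding is_facet_iff by blast
  then have "outward_conormal n P F (a i)" using outward_conormal_iff[of i "a i"] by simp
  then show "\<exists>\<eta>. outward_conormal n P F \<eta>" by (rule exI[where x = "a i"])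
qed

lemma is_edge_hf:
  assumes "v extreme_point_of P" "T \<subseteq> act v" "card T + 1 = n"
  shows "is_edge P (hf T)"
proof -
  have "affine_dim (hf T) = 1" using affine_dim_hf[OF assms(1,2)] assms(3) by linarith
  moreover have "hf T face_of P"
    by (rule hface_face_of[OF order_trans[OF assms(2) act_subset]])
  ultimately show ?thesis unfolding is_edge_def by (rule conjI[rotated])
qed

text \<open>The facet inequalities are the given ones, all of the form \<open>\<langle>a\<^sub>i, \<xi>\<rangle> \<le> 1\<close>.\<close>

lemma monotone_polytope_hpoly:
  assumes "\<And>i. i \<in> I \<Longrightarrow> b i = 1" shows "monotone_polytope n P"
  unfolding monotone_polytope_def Let_def
proof (intro conjI bexI[of _ 0])
  show "smooth_polytope n P" by (rule smooth_polytope_hpoly)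
  have iff: "(\<forall>F \<eta>. is_facet P F \<and> outward_conormal n P F \<eta> \<longrightarrow> pairing n \<eta> \<xi> \<le> 1) \<longleftrightarrow>
      (\<forall>i\<in>I. pairing n (a i) \<xi> \<le> b i)" for \<xi>
  proof (intro iffI allI impI ballI)
    fix i assume A: "\<forall>F \<eta>. is_facet P F \<and> outward_conormal n P F \<eta> \<longrightarrow> pairing n \<eta> \<xi> \<le> 1"
      and i: "i \<in> I"
    have "is_facet P (hf {i})" using i is_facet_iff by blast
    moreover have "outward_conormal n P (hf {i}) (a i)" using outward_conormal_iff[OF i] by simp
    ultimately show "pairing n (a i) \<xi> \<le> b i" using A assms[OF i] by simp
  next
    fix F \<eta> assume B: "\<forall>i\<in>I. pairing n (a i) \<xi> \<le> b i"
      and F: "is_facet P F \<and> outward_conormal n P F \<eta>"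
    then obtain i where i: "i \<in> I" "F = hf {i}" using is_facet_iff[of F] by blast
    then have "\<eta> = a i" using F outward_conormal_iff[OF i(1)] by simp
    then show "pairing n \<eta> \<xi> \<le> 1" using bspec[OF B i(1)] assms[OF i(1)] by simp
  qed
  have "P = {\<xi> \<in> Rspace n. \<forall>F \<eta>. is_facet P F \<and> outward_conormal n P F \<eta> \<longrightarrow> pairing n \<eta> \<xi> \<le> 1}"
    unfolding iff by (simp add: hpoly_def)
  moreover have "(+) 0 ` P = P" by (simp add: image_def)
  ultimately show "(+) 0 ` P = {\<xi> \<in> Rspace n. \<forall>F \<eta>. is_facet ((+) 0 ` P) F \<and>
      outward_conormal n ((+) 0 ` P) F \<eta> \<longrightarrow> pairing n \<eta> \<xi> \<le> 1}" by (simp only:)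
qed (simp add: Rspace_closed)

end

section \<open>Facet inequalities of a full-dimensional polytope\<close>

text \<open>The hull of \<open>insert v V\<close> is the image of the compact set \<open>[0, 1] \<times> convex hull V\<close> under a
  map that is continuous for the product topology on \<^typ>\<open>nat \<Rightarrow> real\<close>.\<close>

lemma compact_convex_hull_finite:
  fixes V :: "(nat \<Rightarrow> real) set"
  assumes "finite V" shows "compact (convex hull V)"
  using assms
proof (induction V rule: finite_induct)
  case (insert v V)
  show ?case
  proof (cases "V = {}")
    case False
    define f where "f = (\<lambda>(s, x) k. (1 - s) * (v k :: real) + s * (x k :: real))"
    have "continuous_on ({0..1} \<times> (convex hull V)) (\<lambda>z. f z k)" for k
    proof -
      have "continuous_on ({0..1} \<times> (convex hull V)) (\<lambda>z::real \<times> (nat \<Rightarrow> real). snd z k)"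
        by (rule continuous_on_compose2[OF continuous_on_product_coordinates]) (auto intro: continuous_intros)
      then show ?thesis unfolding f_def case_prod_beta by (intro continuous_intros)
    qed
    then have "continuous_on ({0..1} \<times> (convex hull V)) f"
      by (rule continuous_on_coordinatewise_then_product)
    then have "compact (f ` ({0..1} \<times> (convex hull V)))"
      by (intro compact_continuous_image compact_Times insert.IH compact_Icc)
    also have "f ` ({0..1} \<times> (convex hull V)) = convex hull (insert v V)"
    proof (rule set_eqI)
      fix y
      have e: "f (s, x) = (1 - s) *\<^sub>R v + s *\<^sub>R x" for s x
        by (simp add: f_def scaleR_fun_def fun_eq_iff)
      have "y \<in> f ` ({0..1} \<times> (convex hull V)) \<longleftrightarrow>
          (\<exists>s x. 0 \<le> s \<and> s \<le> 1 \<and> x \<in> convex hull V \<and> y = (1 - s) *\<^sub>R v + s *\<^sub>R x)"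
        unfolding e[symmetric] by (auto simp: image_iff)
      also have "\<dots> \<longleftrightarrow> (\<exists>u w. 0 \<le> u \<and> 0 \<le> w \<and> u + w = 1 \<and>
          (\<exists>x. x \<in> convex hull V \<and> y = u *\<^sub>R v + w *\<^sub>R x))" (is "?A \<longleftrightarrow> ?B")
      proof
        assume ?A
        then obtain s x where s: "0 \<le> s" "s \<le> 1" "x \<in> convex hull V" "y = (1 - s) *\<^sub>R v + s *\<^sub>R x"
          by (elim exE conjE)
        then show ?B by (intro exI[of _ "1 - s"] exI[of _ s] conjI exI[of _ x]) auto
      next
        assume ?B
        then obtain u w x where s: "0 \<le> u" "0 \<le> w" "u + w = 1" "x \<in> convex hull V"
          "y = u *\<^sub>R v + w *\<^sub>R x"
          by (elim exE conjE)
        moreover from s have "u = 1 - w" by simp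
        ultimately show ?A by (intro exI[of _ w] exI[of _ x]) auto
      qed
      also have "\<dots> \<longleftrightarrow> y \<in> convex hull (insert v V)"
        unfolding convex_hull_insert[OF False] by simp
      finally show "y \<in> f ` ({0..1} \<times> (convex hull V)) \<longleftrightarrow> y \<in> convex hull (insert v V)" .
    qed
    finally show ?thesis .
  qed simp
qed simp

lemma pairing_self_pos:
  assumes "x \<in> Rspace n" "x \<noteq> 0" shows "pairing n x x > 0"
proof -
  obtain k where k: "x k \<noteq> 0" using assms(2) by (metis ext zero_fun_apply)
  have "\<forall>i\<ge>n. x i = 0" using assms(1) by (simp add: Rspace_def)
  then have "k < n" using k by (meson not_le)
  then show ?thesis
    unfolding pairing_def using k
    by (intro sum_pos2[of _ k]) (auto simp: zero_less_mult_iff linorder_neq_iff)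
qed

lemma convex_pairing_le: "convex {x. pairing n d x \<le> c}"
  by (rule convexI) (auto simp: pairing_linear intro: convex_bound_le)

lemma pairing_le_on_hull:
  assumes "\<And>v. v \<in> V \<Longrightarrow> pairing n d v \<le> c" "x \<in> convex hull V"
  shows "pairing n d x \<le> c"
  using hull_minimal[of V "{x. pairing n d x \<le> c}" convex] convex_pairing_le assms by auto

text \<open>The separating functional is the direction to \<open>x\<close> from its nearest point in the hull.\<close>

lemma separating_functional:
  assumes fin: "finite V" "V \<noteq> {}" and VR: "V \<subseteq> Rspace n" and xR: "x \<in> Rspace n"
    and x: "x \<notin> convex hull V"
  shows "\<exists>\<eta>\<in>Rspace n. \<forall>v\<in>V. pairing n \<eta> v < pairing n \<eta> x"
proof -
  let ?H = "convex hull V"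
  let ?q = "\<lambda>y. pairing n (x - y) (x - y)"
  have "continuous_on ?H ?q"
    unfolding pairing_def fun_diff_def
    by (intro continuous_intros continuous_on_subset[OF continuous_on_product_coordinates]) auto
  then obtain p where p: "p \<in> ?H" "\<forall>y\<in>?H. ?q p \<le> ?q y"
    using continuous_attains_inf[OF compact_convex_hull_finite[OF fin(1)]] fin(2) by auto
  have pR: "p \<in> Rspace n"
    using hull_minimal[of V "Rspace n" convex] VR subspace_imp_convex[OF subspace_Rspace] p by auto
  define \<eta> where "\<eta> = x - p"
  have \<eta>R: "\<eta> \<in> Rspace n" unfolding \<eta>_def by (rule Rspace_closed(2)[OF xR pR])
  have "\<eta> \<noteq> 0" using p(1) x by (auto simp: \<eta>_def)
  then have pos: "pairing n \<eta> \<eta> > 0" by (rule pairing_self_pos[OF \<eta>R])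
  have "pairing n \<eta> v \<le> pairing n \<eta> p" if v: "v \<in> V" for v
  proof (rule ccontr)
    define g where "g = pairing n \<eta> (v - p)"
    define h where "h = pairing n (v - p) (v - p)"
    assume "\<not> pairing n \<eta> v \<le> pairing n \<eta> p"
    then have g: "g > 0" by (simp add: g_def pairing_diff_right)
    have h: "h \<ge> 0" by (auto simp: h_def pairing_def intro!: sum_nonneg)
    \<comment> \<open>For this step length the linear gain \<open>2 t g\<close> exceeds the quadratic loss \<open>t\<^sup>2 h\<close>; the
      denominator \<open>h + 1\<close> avoids a case distinction on \<open>h\<close>.\<close>
    define t where "t = min 1 (g / (h + 1))"
    have t: "0 < t" "t \<le> 1" "t * (h + 1) \<le> g"
    proof -
      show "0 < t" "t \<le> 1" using g h by (auto simp: t_def)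
      have "t \<le> g / (h + 1)" by (simp add: t_def)
      then show "t * (h + 1) \<le> g" using h by (simp add: pos_le_divide_eq)
    qed
    have "(1 - t) *\<^sub>R p + t *\<^sub>R v \<in> ?H"
      using t p(1) hull_inc[OF v] by (intro convexD[OF convex_convex_hull]) auto
    then have "?q p \<le> ?q ((1 - t) *\<^sub>R p + t *\<^sub>R v)" by (rule bspec[OF p(2)])
    also have "x - ((1 - t) *\<^sub>R p + t *\<^sub>R v) = \<eta> - t *\<^sub>R (v - p)"
      by (simp add: \<eta>_def algebra_simps)
    also have "pairing n (\<eta> - t *\<^sub>R (v - p)) (\<eta> - t *\<^sub>R (v - p)) =
        pairing n \<eta> \<eta> - 2 * t * g + t * t * h"
      unfolding pairing_diff_left[of n \<eta>] pairing_diff_right[of n _ \<eta>]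
        pairing_scaleR_left pairing_scaleR_right g_def h_def pairing_commute[of n "v - p" \<eta>]
      by (simp add: algebra_simps)
    finally have "2 * t * g \<le> t * t * h" unfolding \<eta>_def[symmetric] by linarith
    then have "t * (2 * g) \<le> t * (t * h)" by (simp add: mult_ac)
    then have "2 * g \<le> t * h" using t by simp
    moreover have "t * h \<le> g" using t by (simp add: distrib_left)
    ultimately show False using g by simp
  qed
  moreover have "pairing n \<eta> p < pairing n \<eta> x"
    using pos by (simp add: \<eta>_def pairing_diff_right)
  ultimately have "\<forall>v\<in>V. pairing n \<eta> v < pairing n \<eta> x" by force
  then show ?thesis by (rule bexI[OF _ \<eta>R])
qed

lemma differences_Rspace: "F \<subseteq> Rspace n \<Longrightarrow> {x - y |x y. x \<in> F \<and> y \<in> F} \<subseteq> Rspace n"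
  by (rule subsetI, elim CollectE exE conjE) (simp add: Rspace_closed(2) subset_eq)

lemma pairing_difference_zero:
  assumes "\<And>x. x \<in> F \<Longrightarrow> pairing n d x = c" "s \<in> {x - y |x y. x \<in> F \<and> y \<in> F}"
  shows "pairing n d s = 0"
proof -
  obtain x y where s: "s = x - y" "x \<in> F" "y \<in> F" using assms(2) by (elim CollectE exE conjE)
  show ?thesis unfolding s(1) pairing_diff_right assms(1)[OF s(2)] assms(1)[OF s(3)] by simp
qed

lemma pairing_zero_on_span:
  assumes "\<And>s. s \<in> S \<Longrightarrow> pairing n d s = 0" "y \<in> span S"
  shows "pairing n d y = 0"
proof -
  have "subspace {y. pairing n d y = 0}"
    by (simp add: subspace_def pairing_right)
  moreover have "S \<subseteq> {y. pairing n d y = 0}" by (rule subsetI, rule CollectI, rule assms(1))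
  ultimately have "span S \<subseteq> {y. pairing n d y = 0}" by (intro span_minimal)
  then show ?thesis using assms(2) by (rule CollectD[OF subsetD])
qed

text \<open>A functional that is constant on \<open>P\<close> kills all differences of points of \<open>P\<close>, and these
  span the space.\<close>

lemma full_dimensional_annihilator:
  assumes "P \<subseteq> Rspace n" "affine_dim P = n" "d \<in> Rspace n" "\<And>x. x \<in> P \<Longrightarrow> pairing n d x = c"
  shows "d = 0"
proof -
  let ?S = "{x - y |x y. x \<in> P \<and> y \<in> P}"
  have S: "?S \<subseteq> Rspace n" by (rule differences_Rspace[OF assms(1)])
  have "span ?S = Rspace n"
    using assms(2) span_eq_Rspace_iff_dim[OF S] by (simp add: affine_dim_def)
  then have "\<forall>d\<in>Rspace n. (\<forall>s\<in>?S. pairing n d s = 0) \<longrightarrow> d = 0"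
    by (rule iffD1[OF span_eq_Rspace_iff[OF S]])
  then show ?thesis
    by (rule mp[OF bspec[OF _ assms(3)]]) (use pairing_difference_zero[OF assms(4)] in \<open>rule ballI\<close>)
qed

text \<open>Let \<open>p\<close> be the barycentre of a finite set \<open>V\<close> of points whose hull is \<open>P\<close>. The polar
  \<open>{\<eta>. \<forall>v\<in>V. \<langle>\<eta>, v - p\<rangle> \<le> 1}\<close> is given by finitely many inequalities and is bounded, so it is
  the hull of its extreme points. A point outside \<open>P\<close> is separated from \<open>P\<close> by an element of the
  polar, hence by an extreme one. Extremality of \<open>\<eta>\<close> says that the vectors \<open>v - p\<close> with equality
  span the space, which means that \<open>\<eta>\<close> supports \<open>P\<close> along a facet. The origin may be an extreme
  point only in dimension zero, where there are no facets; it is left out of \<open>E\<close>.\<close>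

lemma polytope_facet_presentation:
  assumes "polytope P" "P \<subseteq> Rspace n" "P \<noteq> {}" "affine_dim P = n"
  shows "\<exists>E \<kappa>. finite E \<and> E \<subseteq> Rspace n \<and> P = hpoly n E (\<lambda>\<eta>. \<eta>) \<kappa> \<and>
    (\<forall>\<eta>\<in>E. is_facet P {y \<in> P. pairing n \<eta> y = \<kappa> \<eta>})"
proof -
  obtain V where V: "finite V" "P = convex hull V"
    using assms(1) unfolding polytope_def by (elim exE conjE)
  have Vne: "V \<noteq> {}" using V(2) assms(3) by auto
  have VP: "V \<subseteq> P" unfolding V(2) by (rule hull_subset)
  have VR: "V \<subseteq> Rspace n" using VP assms(2) by (rule order_trans)
  define p where "p = (1 / real (card V)) *\<^sub>R (\<Sum>v\<in>V. v)"
  have cardV: "real (card V) > 0" using V(1) Vne by (simp add: card_gt_0_iff)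
  have pR: "p \<in> Rspace n" unfolding p_def using VR by (intro Rspace_closed) auto
  have centre: "(\<Sum>v\<in>V. pairing n d (v - p)) = 0" for d
  proof -
    have "(\<Sum>v\<in>V. pairing n d (v - p)) = (\<Sum>v\<in>V. pairing n d v) - card V * pairing n d p"
      by (simp only: pairing_diff_right sum_subtractf sum_constant)
    moreover have "card V * pairing n d p = (\<Sum>v\<in>V. pairing n d v)"
      using cardV by (simp add: p_def pairing_scaleR_right pairing_sum_right)
    ultimately show ?thesis by (simp only: diff_self)
  qed
  have const: "d = 0" if d: "d \<in> Rspace n" "\<And>v. v \<in> V \<Longrightarrow> pairing n d (v - p) = 0" for d
  proof (rule full_dimensional_annihilator[OF assms(2,4) d(1)])
    fix x assume "x \<in> P"
    then have x: "x \<in> convex hull V" by (simp only: V(2))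
    have "pairing n d v = pairing n d p" if "v \<in> V" for v
      using d(2)[OF that] by (simp add: pairing_diff_right)
    then have "pairing n d x \<le> pairing n d p" "pairing n (- d) x \<le> pairing n (- d) p"
      by (intro pairing_le_on_hull[OF _ x]; simp add: pairing_minus_left)+
    then show "pairing n d x = pairing n d p" by (simp add: pairing_minus_left)
  qed
  let ?A = "\<lambda>v. v - p" and ?one = "\<lambda>_. 1 :: real"
  define polar where "polar = hpoly n V ?A ?one"
  have bounded: "\<forall>d\<in>Rspace n. (\<forall>v\<in>V. pairing n (?A v) d \<le> 0) \<longrightarrow> d = 0"
  proof (intro ballI impI)
    fix d assume d: "d \<in> Rspace n" "\<forall>v\<in>V. pairing n (v - p) d \<le> 0"
    have "\<forall>v\<in>V. - pairing n d (v - p) = 0"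
      using sum_nonneg_eq_0_iff[OF V(1), of "\<lambda>v. - pairing n d (v - p)"] centre[of d] d(2)
      by (simp add: sum_negf pairing_commute[of n d])
    then show "d = 0" using const[OF d(1)] by simp
  qed
  define E where "E = {\<eta>. \<eta> extreme_point_of polar \<and> \<eta> \<noteq> 0}"
  define \<kappa> where "\<kappa> \<eta> = 1 + pairing n \<eta> p" for \<eta>
  have finE: "finite E"
    using finite_extreme_points_hpoly[OF V(1), of n ?A ?one]
    by (rule finite_subset[rotated]) (auto simp: E_def polar_def)
  have Epolar: "E \<subseteq> polar" by (auto simp: E_def extreme_point_of_def)
  have ER: "E \<subseteq> Rspace n" using Epolar hpoly_subset_Rspace unfolding polar_def by (rule order_trans)
  have PE: "P \<subseteq> hpoly n E (\<lambda>\<eta>. \<eta>) \<kappa>"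
  proof
    fix x assume "x \<in> P"
    then have x: "x \<in> convex hull V" "x \<in> Rspace n" using V(2) assms(2) by auto
    have "pairing n \<eta> x \<le> \<kappa> \<eta>" if "\<eta> \<in> E" for \<eta>
    proof (rule pairing_le_on_hull[OF _ x(1)])
      fix v assume "v \<in> V"
      then have "pairing n (v - p) \<eta> \<le> 1" using that Epolar by (auto simp: polar_def hpoly_def)
      then show "pairing n \<eta> v \<le> \<kappa> \<eta>"
        by (simp add: \<kappa>_def pairing_commute[of n _ \<eta>] pairing_diff_right)
    qed
    then show "x \<in> hpoly n E (\<lambda>\<eta>. \<eta>) \<kappa>" using x(2) by (simp add: hpoly_def)
  qed
  have EP: "hpoly n E (\<lambda>\<eta>. \<eta>) \<kappa> \<subseteq> P"
  proof (rule subsetI, rule ccontr)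
    fix x assume x: "x \<in> hpoly n E (\<lambda>\<eta>. \<eta>) \<kappa>" "x \<notin> P"
    have xR: "x \<in> Rspace n" using x(1) by (simp add: hpoly_def)
    have xV: "x \<notin> convex hull V" using x(2) unfolding V(2) .
    obtain \<eta>0 where \<eta>0: "\<eta>0 \<in> Rspace n" "\<forall>v\<in>V. pairing n \<eta>0 v < pairing n \<eta>0 x"
      using separating_functional[OF V(1) Vne VR xR xV] by (elim bexE)
    define M where "M = Max (pairing n \<eta>0 ` V)"
    have M: "pairing n \<eta>0 v \<le> M" if "v \<in> V" for v using that V(1) by (simp add: M_def)
    have "M \<in> pairing n \<eta>0 ` V" using V(1) Vne by (simp add: M_def)
    then have Mx: "M < pairing n \<eta>0 x" using \<eta>0(2) by auto
    define s where "s = M - pairing n \<eta>0 p"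
    have "s > 0"
    proof (rule ccontr)
      assume "\<not> s > 0"
      then have le: "\<forall>v\<in>V. pairing n \<eta>0 (v - p) \<le> 0"
        using M by (force simp: s_def pairing_diff_right)
      then have "\<eta>0 = 0" using bounded \<eta>0(1) by (simp add: pairing_commute[of n _ \<eta>0])
      then show False using \<eta>0(2) Vne by (auto simp: pairing_zero_left)
    qed
    define \<eta> where "\<eta> = (1 / s) *\<^sub>R \<eta>0"
    have "\<eta> \<in> polar"
      unfolding polar_def hpoly_def
    proof (intro CollectI conjI ballI)
      show "\<eta> \<in> Rspace n" unfolding \<eta>_def by (rule Rspace_closed(3)[OF \<eta>0(1)])
      fix v assume "v \<in> V"
      then have "pairing n \<eta>0 (v - p) \<le> s" using M by (simp add: s_def pairing_diff_right)
      then show "pairing n (v - p) \<eta> \<le> 1"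
        using \<open>s > 0\<close> by (simp add: \<eta>_def pairing_scaleR_right pairing_commute[of n _ \<eta>0] field_simps)
    qed
    then have hull: "\<eta> \<in> convex hull {\<eta>'. \<eta>' extreme_point_of polar \<and>
        active n V ?A ?one \<eta> \<subseteq> active n V ?A ?one \<eta>'}"
      unfolding polar_def by (rule in_hull_of_extreme_points[OF V(1) bounded])
    have "pairing n (x - p) \<eta> \<le> 1"
    proof (rule pairing_le_on_hull[OF _ hull])
      fix \<eta>' assume "\<eta>' \<in> {\<eta>'. \<eta>' extreme_point_of polar \<and>
          active n V ?A ?one \<eta> \<subseteq> active n V ?A ?one \<eta>'}"
      then have ext: "\<eta>' extreme_point_of polar" by simp
      show "pairing n (x - p) \<eta>' \<le> 1"
      proof (cases "\<eta>' = 0")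
        case False
        then have "\<eta>' \<in> E" using ext by (simp add: E_def)
        then have "pairing n \<eta>' x \<le> \<kappa> \<eta>'" using x(1) by (simp add: hpoly_def)
        then show ?thesis by (simp add: \<kappa>_def pairing_commute[of n _ \<eta>'] pairing_diff_right)
      qed (simp add: pairing_zero_right)
    qed
    then have "pairing n \<eta>0 (x - p) \<le> s"
      using \<open>s > 0\<close> by (simp add: \<eta>_def pairing_scaleR_right pairing_commute[of n _ \<eta>0] field_simps)
    then show False using Mx by (simp add: s_def pairing_diff_right)
  qed
  have PH: "P = hpoly n E (\<lambda>\<eta>. \<eta>) \<kappa>" using PE EP by (rule subset_antisym)
  have "is_facet P {y \<in> P. pairing n \<eta> y = \<kappa> \<eta>}" if \<eta>: "\<eta> \<in> E" for \<eta>
  proof -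
    let ?F = "{y \<in> P. pairing n \<eta> y = \<kappa> \<eta>}"
    let ?S = "{x - y |x y. x \<in> ?F \<and> y \<in> ?F}"
    have \<eta>R: "\<eta> \<in> Rspace n" using \<eta> ER by blast
    have ext: "\<eta> extreme_point_of hpoly n V ?A ?one" and "\<eta> \<noteq> 0"
      using \<eta> by (auto simp: E_def polar_def)
    have rigid: "d = 0" if "d \<in> Rspace n" "\<forall>v\<in>active n V ?A ?one \<eta>. pairing n (v - p) d = 0" for d
      using ext that unfolding extreme_point_hpoly_iff[OF V(1)] by simp
    have tightF: "v \<in> ?F" if v: "v \<in> active n V ?A ?one \<eta>" for v
    proof (intro CollectI conjI)
      show "v \<in> P" using v VP by (auto simp: active_def)
      have "pairing n (v - p) \<eta> = 1" using v unfolding active_def by (elim CollectE conjE)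
      then show "pairing n \<eta> v = \<kappa> \<eta>"
        by (simp add: \<kappa>_def pairing_commute[of n _ \<eta>] pairing_diff_right)
    qed
    have "\<exists>v. v \<in> active n V ?A ?one \<eta>"
    proof (rule ccontr)
      assume "\<nexists>v. v \<in> active n V ?A ?one \<eta>"
      then show False using rigid[OF \<eta>R] \<open>\<eta> \<noteq> 0\<close> by simp
    qed
    then obtain v0 where v0: "v0 \<in> active n V ?A ?one \<eta>" by (rule exE)
    define u where "u = v0 - p"
    have u1: "pairing n \<eta> u = 1"
      using v0 unfolding u_def active_def pairing_commute[of n \<eta>] by (elim CollectE conjE)
    have SR: "?S \<subseteq> Rspace n" using assms(2) by (intro differences_Rspace) auto
    have uR: "u \<in> Rspace n"
      unfolding u_def using v0 VR by (intro Rspace_closed(2)[OF _ pR]) (auto simp: active_def)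
    have u: "u \<notin> span ?S"
    proof
      assume "u \<in> span ?S"
      moreover have "pairing n \<eta> s = 0" if "s \<in> ?S" for s
        by (rule pairing_difference_zero[OF _ that, of n \<eta> "\<kappa> \<eta>"]) simp
      ultimately have "pairing n \<eta> u = 0" by (rule pairing_zero_on_span[rotated])
      then show False using u1 by simp
    qed
    have insub: "insert u ?S \<subseteq> Rspace n" using SR uR by (simp only: insert_subset)
    have "\<forall>d\<in>Rspace n. (\<forall>s\<in>insert u ?S. pairing n d s = 0) \<longrightarrow> d = 0"
    proof (intro ballI impI)
      fix d assume d: "d \<in> Rspace n" "\<forall>s\<in>insert u ?S. pairing n d s = 0"
      show "d = 0"
      proof (rule rigid[OF d(1)], rule ballI)
        fix v assume v: "v \<in> active n V ?A ?one \<eta>"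
        have "v - v0 \<in> ?S"
          by (intro CollectI exI[of _ v] exI[of _ v0] conjI refl tightF v v0)
        then have "pairing n d (v - v0) = 0" by (rule bspec[OF d(2) insertI2])
        moreover have "pairing n d u = 0" by (rule bspec[OF d(2) insertI1])
        ultimately show "pairing n (v - p) d = 0"
          by (simp add: u_def pairing_commute[of n _ d] pairing_diff_right)
      qed
    qed
    then have "span (insert u ?S) = Rspace n" by (rule iffD2[OF span_eq_Rspace_iff[OF insub]])
    then have "dim (insert u ?S) = n" by (rule iffD1[OF span_eq_Rspace_iff_dim[OF insub]])
    then have dimF: "affine_dim ?F + 1 = n"
      using dim_insert_new[OF SR uR u] unfolding affine_dim_def by linarith
    have "hface n E (\<lambda>\<eta>. \<eta>) \<kappa> {\<eta>} face_of hpoly n E (\<lambda>\<eta>. \<eta>) \<kappa>"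
      by (rule hface_face_of) (use \<eta> in simp)
    then have face: "?F face_of P" unfolding hface_def PH[symmetric] by simp
    have "?F \<noteq> {}" using tightF[OF v0] by force
    then show ?thesis
      unfolding is_facet_def assms(4) using dimF face by (intro conjI)
  qed
  then show ?thesis using finE ER PH by (intro exI[of _ E] exI[of _ \<kappa>]) simp
qed

text \<open>The differences of points of \<open>F\<close> and one vector \<open>u\<close> leading from a point of \<open>P\<close> off \<open>F\<close>
  into \<open>F\<close> span the space. Both functionals vanish on the former and are positive on \<open>u\<close>.\<close>

lemma facet_functional_unique:
  assumes PR: "P \<subseteq> Rspace n" and dimP: "affine_dim P = n"
    and F: "is_facet P F"
    and a: "a \<in> Rspace n" "\<And>y. y \<in> P \<Longrightarrow> pairing n a y \<le> \<beta>" "F = {y \<in> P. pairing n a y = \<beta>}"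
    and c: "c \<in> Rspace n" "\<And>y. y \<in> P \<Longrightarrow> pairing n c y \<le> \<gamma>" "F = {y \<in> P. pairing n c y = \<gamma>}"
  shows "\<exists>t>0. c = t *\<^sub>R a \<and> \<gamma> = t * \<beta>"
proof -
  let ?S = "{x - y |x y. x \<in> F \<and> y \<in> F}"
  have dimF: "affine_dim F + 1 = n" using F dimP by (simp add: is_facet_def)
  have "F \<noteq> P" using dimF dimP by auto
  then obtain p where p: "p \<in> P" "p \<notin> F" using a(3) by blast
  obtain v where v: "v \<in> F" using F by (auto simp: is_facet_def)
  define u where "u = v - p"
  have vP: "v \<in> P" "pairing n a v = \<beta>" using v a(3) by auto
  have cv: "pairing n c v = \<gamma>" using v c(3) by auto
  have "pairing n a p \<noteq> \<beta>" "pairing n c p \<noteq> \<gamma>" using p a(3) c(3) by auto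
  then have ua: "pairing n a u > 0" and uc: "pairing n c u > 0"
    using a(2)[OF p(1)] c(2)[OF p(1)] vP cv by (simp_all add: u_def pairing_diff_right)
  have uR: "u \<in> Rspace n" unfolding u_def using vP p PR by (intro Rspace_closed) auto
  have FR: "F \<subseteq> Rspace n" using PR a(3) by auto
  have SR: "?S \<subseteq> Rspace n" by (rule differences_Rspace[OF FR])
  have aS: "pairing n a s = 0" "pairing n c s = 0" if sS: "s \<in> ?S" for s
  proof -
    have "pairing n a y = \<beta>" if "y \<in> F" for y using that a(3) by auto
    then show "pairing n a s = 0" using sS by (rule pairing_difference_zero)
    have "pairing n c y = \<gamma>" if "y \<in> F" for y using that c(3) by auto
    then show "pairing n c s = 0" using sS by (rule pairing_difference_zero)
  qed
  have u: "u \<notin> span ?S"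
    using pairing_zero_on_span[OF aS(1), of ?S u] ua by (intro notI) simp
  have "dim (insert u ?S) = n"
    using dim_insert_new[OF SR uR u] dimF by (simp add: affine_dim_def)
  then have sp: "span (insert u ?S) = Rspace n"
    using span_eq_Rspace_iff_dim[of "insert u ?S" n] SR uR by simp
  define t where "t = pairing n c u / pairing n a u"
  have "t > 0" using ua uc by (simp add: t_def)
  have "c - t *\<^sub>R a = 0"
  proof -
    have "c - t *\<^sub>R a \<in> Rspace n" using a(1) c(1) by (intro Rspace_closed) auto
    moreover have "\<forall>s\<in>insert u ?S. pairing n (c - t *\<^sub>R a) s = 0"
    proof
      fix s assume "s \<in> insert u ?S"
      then show "pairing n (c - t *\<^sub>R a) s = 0"
      proof (rule insertE)
        assume "s = u"
        then show ?thesis using ua by (simp add: pairing_diff_left pairing_scaleR_left t_def)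
      next
        assume "s \<in> ?S"
        then show ?thesis using aS[of s] by (simp only: pairing_diff_left pairing_scaleR_left mult_zero_right diff_self)
      qed
    qed
    moreover have sub: "insert u ?S \<subseteq> Rspace n" using SR uR by simp
    ultimately show ?thesis
      by (intro mp[OF bspec[OF iffD1[OF span_eq_Rspace_iff[OF sub] sp]]])
  qed
  then have ct: "c = t *\<^sub>R a" by simp
  moreover have "\<gamma> = t * \<beta>" using cv vP by (simp add: ct pairing_scaleR_left)
  ultimately show ?thesis using \<open>t > 0\<close> by (intro exI[of _ t]) simp
qed

section \<open>Presentation of a smooth polytope by its facets\<close>

text \<open>Two conormals of one facet are proportional by \<open>facet_functional_unique\<close>, but they are
  both members of the lattice basis at \<open>v\<close>, which is independent.\<close>

lemma conormals_through_vertex_unique: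
  assumes sm: "smooth_polytope n P" and v: "v extreme_point_of P" and F: "is_facet P F" "v \<in> F"
    and \<eta>: "outward_conormal n P F \<eta>" "outward_conormal n P F \<zeta>"
  shows "\<eta> = \<zeta>"
proof (rule ccontr)
  assume ne: "\<eta> \<noteq> \<zeta>"
  let ?B = "{\<eta>. \<exists>F. is_facet P F \<and> v \<in> F \<and> outward_conormal n P F \<eta>}"
  have PR: "P \<subseteq> Rspace n" and dimP: "affine_dim P = n" and B: "lattice_basis n ?B"
    using sm v unfolding smooth_polytope_def by simp_all
  have mem: "\<eta> \<in> ?B" "\<zeta> \<in> ?B"
    by (rule CollectI, rule exI[of _ F], intro conjI F \<eta>)+
  obtain D where D: "(\<forall>b\<in>?B. D b \<in> Zlattice n) \<and>
      (\<forall>b\<in>?B. \<forall>c\<in>?B. pairing n b (D c) = (if b = c then 1 else 0))"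
    using lattice_basis_dual[OF B] by (rule exE)
  have d1: "pairing n \<eta> (D \<eta>) = 1"
    using bspec[OF bspec[OF conjunct2[OF D] mem(1)] mem(1)] by simp
  have d2: "pairing n \<zeta> (D \<eta>) = 0"
    using bspec[OF bspec[OF conjunct2[OF D] mem(2)] mem(1)] ne by simp
  obtain \<beta> where \<beta>: "(\<forall>\<xi>\<in>P. pairing n \<eta> \<xi> \<le> \<beta>) \<and> F = {\<xi> \<in> P. pairing n \<eta> \<xi> = \<beta>}"
    using conjunct2[OF \<eta>(1)[unfolded outward_conormal_def]] by (rule exE)
  obtain \<gamma> where \<gamma>: "(\<forall>\<xi>\<in>P. pairing n \<zeta> \<xi> \<le> \<gamma>) \<and> F = {\<xi> \<in> P. pairing n \<zeta> \<xi> = \<gamma>}"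
    using conjunct2[OF \<eta>(2)[unfolded outward_conormal_def]] by (rule exE)
  have R: "\<eta> \<in> Rspace n" "\<zeta> \<in> Rspace n"
    using \<eta> by (simp_all add: outward_conormal_def primitive_vector_def Zlattice_imp_Rspace)
  have le: "pairing n \<eta> y \<le> \<beta>" "pairing n \<zeta> y \<le> \<gamma>" if "y \<in> P" for y
    using \<beta> \<gamma> that by simp_all
  obtain t where t: "t > 0 \<and> \<zeta> = t *\<^sub>R \<eta> \<and> \<gamma> = t * \<beta>"
    using facet_functional_unique[OF PR dimP F(1) R(1) le(1) conjunct2[OF \<beta>] R(2) le(2) conjunct2[OF \<gamma>]]
    by (rule exE)
  then have "pairing n \<zeta> (D \<eta>) = t" using d1 by (simp add: pairing_scaleR_left)
  then show False using d2 t by simp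
qed

text \<open>Each inequality of \<open>polytope_facet_presentation\<close> is a positive multiple of the inequality
  given by the conormal of its facet, so the latter inequalities cut out \<open>P\<close> as well.\<close>

lemma smooth_polytope_presentation:
  assumes sm: "smooth_polytope n P"
  shows "\<exists>a b. smooth_presentation n {F. is_facet P F} a b \<and> P = hpoly n {F. is_facet P F} a b"
proof -
  let ?I = "{F. is_facet P F}"
  have poly: "polytope P" and PR: "P \<subseteq> Rspace n" and Pne: "P \<noteq> {}" and dimP: "affine_dim P = n"
    and conormals: "\<forall>F. is_facet P F \<longrightarrow> (\<exists>\<eta>. outward_conormal n P F \<eta>)"
    and bas: "\<And>v. v extreme_point_of P \<Longrightarrow>
      lattice_basis n {\<eta>. \<exists>F. is_facet P F \<and> v \<in> F \<and> outward_conormal n P F \<eta>}"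
    using sm unfolding smooth_polytope_def by simp_all
  obtain E \<kappa> where E: "finite E" "E \<subseteq> Rspace n" "P = hpoly n E (\<lambda>\<eta>. \<eta>) \<kappa>"
    "\<forall>\<eta>\<in>E. is_facet P {y \<in> P. pairing n \<eta> y = \<kappa> \<eta>}"
    using polytope_facet_presentation[OF poly PR Pne dimP] by (elim exE conjE)
  have "?I \<subseteq> hface n E (\<lambda>\<eta>. \<eta>) \<kappa> ` Pow E"
  proof
    fix F assume "F \<in> ?I"
    then have F: "F face_of hpoly n E (\<lambda>\<eta>. \<eta>) \<kappa>" "F \<noteq> {}"
      using E(3) by (simp_all add: is_facet_def)
    obtain x where x: "x \<in> F" "F = hface n E (\<lambda>\<eta>. \<eta>) \<kappa> (active n E (\<lambda>\<eta>. \<eta>) \<kappa> x)"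
      by (rule face_of_hpoly[OF E(1) F])
    show "F \<in> hface n E (\<lambda>\<eta>. \<eta>) \<kappa> ` Pow E"
      by (subst x(2), rule imageI) (simp add: active_def)
  qed
  then have finI: "finite ?I" using E(1) by (rule finite_subset[OF _ finite_imageI[OF finite_Pow_iff[THEN iffD2]]])
  define a where "a F = (SOME \<eta>. outward_conormal n P F \<eta>)" for F
  define b where "b F = (SOME \<beta>. (\<forall>\<xi>\<in>P. pairing n (a F) \<xi> \<le> \<beta>) \<and> F = {\<xi> \<in> P. pairing n (a F) \<xi> = \<beta>})" for F
  have oc: "outward_conormal n P F (a F)" if "is_facet P F" for F
    unfolding a_def by (rule someI_ex[OF mp[OF spec[OF conormals] that]])
  have ab: "(\<forall>\<xi>\<in>P. pairing n (a F) \<xi> \<le> b F) \<and> F = {\<xi> \<in> P. pairing n (a F) \<xi> = b F}"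
    if "is_facet P F" for F
    unfolding b_def
    by (rule someI_ex[OF conjunct2[OF oc[OF that, unfolded outward_conormal_def]]])
  have le: "pairing n (a F) \<xi> \<le> b F" if "is_facet P F" "\<xi> \<in> P" for F \<xi>
    using bspec[OF conjunct1[OF ab[OF that(1)]] that(2)] .
  have mem: "\<xi> \<in> F \<longleftrightarrow> pairing n (a F) \<xi> = b F" if "is_facet P F" "\<xi> \<in> P" for F \<xi>
  proof -
    have "\<xi> \<in> F \<longleftrightarrow> \<xi> \<in> {\<xi> \<in> P. pairing n (a F) \<xi> = b F}"
      using conjunct2[OF ab[OF that(1)]] by (rule arg_cong[where f = "\<lambda>X. \<xi> \<in> X"])
    then show ?thesis using that(2) by simp
  qed
  have aR: "a F \<in> Rspace n" if "is_facet P F" for F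
    using oc[OF that] by (simp add: outward_conormal_def primitive_vector_def Zlattice_imp_Rspace)
  have sub1: "P \<subseteq> hpoly n ?I a b"
    using PR le by (auto simp: hpoly_def)
  have sub2: "hpoly n ?I a b \<subseteq> P"
  proof
    fix x assume x: "x \<in> hpoly n ?I a b"
    have "pairing n \<eta> x \<le> \<kappa> \<eta>" if \<eta>: "\<eta> \<in> E" for \<eta>
    proof -
      let ?F = "{y \<in> P. pairing n \<eta> y = \<kappa> \<eta>}"
      have F: "is_facet P ?F" by (rule bspec[OF E(4) \<eta>])
      have \<eta>R: "\<eta> \<in> Rspace n" by (rule subsetD[OF E(2) \<eta>])
      have \<eta>le: "pairing n \<eta> y \<le> \<kappa> \<eta>" if "y \<in> P" for y
        using that \<eta> unfolding E(3) hpoly_def by simp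
      obtain t where t: "t > 0 \<and> \<eta> = t *\<^sub>R a ?F \<and> \<kappa> \<eta> = t * b ?F"
        using facet_functional_unique[OF PR dimP F aR[OF F] le[OF F] conjunct2[OF ab[OF F]] \<eta>R \<eta>le refl]
        by (rule exE)
      have "pairing n (a ?F) x \<le> b ?F" using x F unfolding hpoly_def by simp
      then have "t * pairing n (a ?F) x \<le> t * b ?F" using t by (intro mult_left_mono) simp_all
      also have "t * pairing n (a ?F) x = pairing n \<eta> x"
        using t by (metis pairing_scaleR_left)
      finally show ?thesis using t by linarith
    qed
    moreover have "x \<in> Rspace n" using x by (simp add: hpoly_def)
    ultimately show "x \<in> P" unfolding E(3) hpoly_def by simp
  qed
  have PI: "P = hpoly n ?I a b" using sub1 sub2 by (rule subset_antisym)
  have "smooth_presentation n ?I a b"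
  proof
    show "finite ?I" by (rule finI)
    show "\<forall>d\<in>Rspace n. (\<forall>F\<in>?I. pairing n (a F) d \<le> 0) \<longrightarrow> d = 0"
    proof (intro ballI impI, rule ccontr)
      fix d assume d: "d \<in> Rspace n" "\<forall>F\<in>?I. pairing n (a F) d \<le> 0" "d \<noteq> 0"
      obtain x where x: "x \<in> P" using Pne by auto
      obtain V where V: "finite V" "P = convex hull V"
        using poly unfolding polytope_def by (elim exE conjE)
      have Vne: "V \<noteq> {}" using V(2) Pne by auto
      define M where "M = Max (pairing n d ` V)"
      have M: "pairing n d y \<le> M" if "y \<in> P" for y
      proof (rule pairing_le_on_hull)
        show "y \<in> convex hull V" using that V(2) by simp
        show "pairing n d v \<le> M" if "v \<in> V" for v using that V(1) by (simp add: M_def)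
      qed
      have dd: "pairing n d d > 0" by (rule pairing_self_pos[OF d(1,3)])
      \<comment> \<open>Moving this far along \<open>d\<close> raises the pairing with \<open>d\<close> above its maximum on \<open>P\<close>.\<close>
      define s where "s = (M - pairing n d x + 1) / pairing n d d"
      have s: "s \<ge> 0" using M[OF x] dd by (simp add: s_def)
      have "x + s *\<^sub>R d \<in> hpoly n ?I a b"
        unfolding hpoly_def
      proof (intro CollectI conjI ballI)
        show "x + s *\<^sub>R d \<in> Rspace n"
          using PR x d(1) by (intro Rspace_closed) auto
        fix F assume F: "F \<in> ?I"
        have "s * pairing n (a F) d \<le> 0" using bspec[OF d(2) F] s by (simp add: mult_nonneg_nonpos)
        then show "pairing n (a F) (x + s *\<^sub>R d) \<le> b F"
          using le[of F x] F x by (simp add: pairing_right)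
      qed
      then have "pairing n d (x + s *\<^sub>R d) \<le> M" unfolding PI[symmetric] by (rule M)
      then have "pairing n d x + s * pairing n d d \<le> M" by (simp add: pairing_right)
      then show False using dd by (simp add: s_def)
    qed
    show "\<exists>x\<in>hpoly n ?I a b. pairing n (a F) x = b F" if "F \<in> ?I" for F
    proof -
      have F: "is_facet P F" using that by simp
      then obtain x where x: "x \<in> F" by (auto simp: is_facet_def)
      have "F \<subseteq> P" using F face_of_imp_subset[of F P] by (simp add: is_facet_def)
      then have xP: "x \<in> P" using x by (rule subsetD)
      then have "pairing n (a F) x = b F" using mem[OF F xP] x by simp
      then show ?thesis using xP PI by (intro bexI[of _ x]) simp_all
    qed
    fix v assume "v extreme_point_of hpoly n ?I a b"
    then have v: "v extreme_point_of P" unfolding PI[symmetric] .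
    then have vP: "v \<in> P" by (simp add: extreme_point_of_def)
    have act: "active n ?I a b v = {F. is_facet P F \<and> v \<in> F}"
      using mem[OF _ vP] unfolding active_def by auto
    show "inj_on a (active n ?I a b v)"
      unfolding act
    proof (rule inj_onI)
      fix F G assume F: "F \<in> {F. is_facet P F \<and> v \<in> F}" and G: "G \<in> {F. is_facet P F \<and> v \<in> F}"
        and eq: "a F = a G"
      have F': "is_facet P F" "v \<in> F" and G': "is_facet P G" "v \<in> G" using F G by simp_all
      have "b F = b G" using mem[OF F'(1) vP] mem[OF G'(1) vP] F' G' eq by simp
      then show "F = G" using conjunct2[OF ab[OF F'(1)]] conjunct2[OF ab[OF G'(1)]] eq by simp
    qed
    have "(\<exists>F. is_facet P F \<and> v \<in> F \<and> outward_conormal n P F \<eta>) \<longleftrightarrow>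
        (\<exists>F\<in>{F. is_facet P F \<and> v \<in> F}. \<eta> = a F)" for \<eta>
    proof
      assume "\<exists>F. is_facet P F \<and> v \<in> F \<and> outward_conormal n P F \<eta>"
      then obtain F where F: "is_facet P F" "v \<in> F" "outward_conormal n P F \<eta>" by (elim exE conjE)
      have "\<eta> = a F" by (rule conormals_through_vertex_unique[OF sm v F oc[OF F(1)]])
      then show "\<exists>F\<in>{F. is_facet P F \<and> v \<in> F}. \<eta> = a F" using F by (intro bexI[of _ F]) simp_all
    next
      assume "\<exists>F\<in>{F. is_facet P F \<and> v \<in> F}. \<eta> = a F"
      then obtain F where F: "F \<in> {F. is_facet P F \<and> v \<in> F}" "\<eta> = a F" by (rule bexE)
      then show "\<exists>F. is_facet P F \<and> v \<in> F \<and> outward_conormal n P F \<eta>"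
        using oc[of F] by (intro exI[of _ F]) simp
    qed
    then have "{\<eta>. \<exists>F. is_facet P F \<and> v \<in> F \<and> outward_conormal n P F \<eta>} = a ` active n ?I a b v"
      unfolding act image_def by (simp only:)
    then show "lattice_basis n (a ` active n ?I a b v)"
      using bas[OF v] by (simp only:)
  qed
  then show ?thesis using PI by (intro exI[of _ a] exI[of _ b] conjI)
qed

section \<open>Expansion along all facets\<close>

text \<open>The inequality with constant \<open>1 + r i\<close> is replaced by \<open>r i + 1\<close> inequalities with constant
  \<open>1\<close>, which share its slack. With this choice of constants the expansion is monotone without a
  further translation.\<close>

locale facet_expansion = core: smooth_presentation n I a "\<lambda>i. 1 + real (r i)"
  for n :: nat and I :: "'i set" and a :: "'i \<Rightarrow> nat \<Rightarrow> real" and r :: "'i \<Rightarrow> nat" +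
  assumes r_pos: "\<And>i. i \<in> I \<Longrightarrow> 1 \<le> r i"
begin

text \<open>The new coordinates are labelled by \<open>(i, j)\<close> with \<open>j < r i\<close>. The inequalities of group \<open>i\<close>
  are labelled by \<open>(i, j)\<close> with \<open>j \<le> r i\<close>: those with \<open>j < r i\<close> bound a new coordinate from
  below, and the one with \<open>j = r i\<close> descends from the \<open>i\<close>-th inequality of the core.\<close>

definition fibre_labels :: "('i \<times> nat) set" where "fibre_labels = (SIGMA i:I. {..<r i})"

definition labels :: "('i \<times> nat) set" where "labels = (SIGMA i:I. {..r i})"

text \<open>An arbitrary enumeration, which puts the new coordinates in the positions from \<open>n\<close> on.\<close>

definition coord_label :: "nat \<Rightarrow> 'i \<times> nat" where
  "coord_label = (SOME f. bij_betw f {0..<card fibre_labels} fibre_labels)"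

definition total_dim :: nat where "total_dim = n + card fibre_labels"

text \<open>Through \<open>lift\<close> the larger space is the product of the base space and the space of families
  of new coordinates; \<open>base\<close> and \<open>fibre\<close> are the projections.\<close>

definition lift :: "(nat \<Rightarrow> real) \<Rightarrow> ('i \<times> nat \<Rightarrow> real) \<Rightarrow> nat \<Rightarrow> real" where
  "lift x u = (\<lambda>q. if q < n then x q else if q < total_dim then u (coord_label (q - n)) else 0)"

definition base :: "(nat \<Rightarrow> real) \<Rightarrow> nat \<Rightarrow> real" where
  "base z = (\<lambda>q. if q < n then z q else 0)"

definition fibre :: "(nat \<Rightarrow> real) \<Rightarrow> 'i \<times> nat \<Rightarrow> real" where
  "fibre z p = z (n + inv_into {0..<card fibre_labels} coord_label p)"

definition conormal :: "'i \<times> nat \<Rightarrow> nat \<Rightarrow> real" where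
  "conormal p = (if snd p < r (fst p) then lift 0 (\<lambda>q. if q = p then - 1 else 0)
          else lift (a (fst p)) (\<lambda>q. if fst q = fst p then 1 else 0))"

abbreviation "core_polytope \<equiv> hpoly n I a (\<lambda>i. 1 + real (r i))"
abbreviation "core_active \<equiv> active n I a (\<lambda>i. 1 + real (r i))"
abbreviation "expansion \<equiv> hpoly total_dim labels conormal (\<lambda>_. 1)"
abbreviation "exp_active \<equiv> active total_dim labels conormal (\<lambda>_. 1)"
abbreviation "exp_face \<equiv> hface total_dim labels conormal (\<lambda>_. 1)"

lemma finite_fibre_labels: "finite fibre_labels" and finite_labels: "finite labels"
  using core.finite_index by (auto simp: fibre_labels_def labels_def)

lemma fibre_labels_subset: "fibre_labels \<subseteq> labels" by (auto simp: fibre_labels_def labels_def)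

lemma bij_coord_label: "bij_betw coord_label {0..<card fibre_labels} fibre_labels"
  unfolding coord_label_def by (rule someI_ex[OF ex_bij_betw_nat_finite[OF finite_fibre_labels]])

lemma lift_Rspace: "lift x u \<in> Rspace total_dim"
  by (auto simp: Rspace_def lift_def total_dim_def)

lemma pairing_lift: "pairing total_dim (lift x u) (lift y w) = pairing n x y + (\<Sum>p\<in>fibre_labels. u p * w p)"
proof -
  let ?f = "\<lambda>q. lift x u q * lift y w q"
  have "pairing total_dim (lift x u) (lift y w) = sum ?f {0..<n} + sum ?f {n..<total_dim}"
    unfolding pairing_def lessThan_atLeast0
    by (rule sum.atLeastLessThan_concat[symmetric]) (auto simp: total_dim_def)
  also have "sum ?f {0..<n} = pairing n x y"
    unfolding pairing_def lessThan_atLeast0 by (rule sum.cong) (auto simp: lift_def)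
  also have "sum ?f {n..<total_dim} = (\<Sum>k\<in>{0..<card fibre_labels}. ?f (k + n))"
    using sum.shift_bounds_nat_ivl[of ?f 0 n "card fibre_labels"] by (simp add: total_dim_def add.commute)
  also have "\<dots> = (\<Sum>k\<in>{0..<card fibre_labels}. u (coord_label k) * w (coord_label k))"
    by (rule sum.cong) (auto simp: lift_def total_dim_def)
  also have "\<dots> = (\<Sum>p\<in>fibre_labels. u p * w p)"
    by (rule sum.reindex_bij_betw[OF bij_coord_label])
  finally show ?thesis .
qed

lemma base_Rspace: "base z \<in> Rspace n"
  by (simp add: base_def Rspace_def)

lemma lift_base_fibre:
  assumes "z \<in> Rspace total_dim" shows "lift (base z) (fibre z) = z"
proof
  fix q
  have "inv_into {0..<card fibre_labels} coord_label (coord_label (q - n)) = q - n" if "q < total_dim" "\<not> q < n"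
    using that by (intro inv_into_f_f bij_betw_imp_inj_on[OF bij_coord_label]) (auto simp: total_dim_def)
  then show "lift (base z) (fibre z) q = z q"
    using assms by (auto simp: lift_def base_def fibre_def Rspace_def)
qed

lemma base_lift: "x \<in> Rspace n \<Longrightarrow> base (lift x u) = x"
  by (auto simp: base_def lift_def Rspace_def fun_eq_iff)

lemma lift_add: "lift (x + y) (\<lambda>p. u p + w p) = lift x u + lift y w"
  by (auto simp: lift_def fun_eq_iff)

lemma lift_scale: "lift (c *\<^sub>R x) (\<lambda>p. c * u p) = c *\<^sub>R lift x u"
  by (auto simp: lift_def fun_eq_iff scaleR_fun_def)

lemma lift_sum: "lift (\<Sum>k\<in>S. x k) (\<lambda>p. \<Sum>k\<in>S. u k p) = (\<Sum>k\<in>S. lift (x k) (u k))"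
  by (auto simp: lift_def fun_eq_iff sum_fun_apply)

lemma lift_cong:
  assumes "\<And>p. p \<in> fibre_labels \<Longrightarrow> u p = w p" shows "lift x u = lift x w"
proof
  fix q
  have "coord_label (q - n) \<in> fibre_labels" if "q < total_dim" "\<not> q < n"
    using that by (intro bij_betwE[OF bij_coord_label, rule_format]) (auto simp: total_dim_def)
  then show "lift x u q = lift x w q" using assms by (auto simp: lift_def)
qed

lemma lift_0: "(\<And>p. p \<in> fibre_labels \<Longrightarrow> u p = 0) \<Longrightarrow> lift 0 u = 0"
  by (subst lift_cong[of u "\<lambda>_. 0"]) (auto simp: lift_def fun_eq_iff)

lemma lift_Zlattice:
  assumes "x \<in> Zlattice n" "\<And>p. p \<in> fibre_labels \<Longrightarrow> u p \<in> \<int>" shows "lift x u \<in> Zlattice total_dim"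
proof -
  have "coord_label (q - n) \<in> fibre_labels" if "q < total_dim" "\<not> q < n" for q
    using that by (intro bij_betwE[OF bij_coord_label, rule_format]) (auto simp: total_dim_def)
  then have "\<forall>q. lift x u q \<in> \<int>" using assms by (auto simp: lift_def Zlattice_iff)
  then show ?thesis using lift_Rspace by (simp add: Zlattice_iff)
qed

lemma fibre_Zlattice:
  assumes "z \<in> Zlattice total_dim" shows "base z \<in> Zlattice n" "fibre z p \<in> \<int>"
  using assms by (auto simp: Zlattice_iff base_def fibre_def Rspace_def)

lemma conormal_Zlattice_labels: "p \<in> labels \<Longrightarrow> conormal p \<in> Zlattice total_dim"
  unfolding conormal_def
  by (auto intro!: lift_Zlattice core.conormal_Zlattice Zlattice_zero simp: labels_def)

lemma pairing_conormal_low: "(i, j) \<in> fibre_labels \<Longrightarrow> pairing total_dim (conormal (i, j)) (lift x u) = - u (i, j)"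
proof -
  assume p: "(i, j) \<in> fibre_labels"
  then have "pairing total_dim (conormal (i, j)) (lift x u) = (\<Sum>q\<in>fibre_labels. (if q = (i, j) then - 1 else 0) * u q)"
    by (simp add: conormal_def fibre_labels_def pairing_lift pairing_zero_left)
  also have "\<dots> = (\<Sum>q\<in>fibre_labels. if q = (i, j) then - u q else 0)" by (rule sum.cong) auto
  finally show ?thesis using p finite_fibre_labels by simp
qed

lemma sum_over_group:
  fixes u :: "'i \<times> nat \<Rightarrow> real"
  assumes i: "i \<in> I"
  shows "(\<Sum>p\<in>fibre_labels. (if fst p = i then 1 else 0) * u p) = (\<Sum>j<r i. u (i, j))"
proof -
  have "(\<Sum>p\<in>fibre_labels. (if fst p = i then 1 else 0) * u p) =
      (\<Sum>i'\<in>I. \<Sum>j<r i'. (if i' = i then 1 else 0) * u (i', j))"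
    unfolding fibre_labels_def using core.finite_index by (subst sum.Sigma) (auto intro: sum.cong)
  also have "\<dots> = (\<Sum>i'\<in>I. if i' = i then (\<Sum>j<r i'. u (i', j)) else 0)"
    by (rule sum.cong) auto
  finally show ?thesis using i core.finite_index by simp
qed

lemma pairing_conormal_top: "i \<in> I \<Longrightarrow> pairing total_dim (conormal (i, r i)) (lift x u) = pairing n (a i) x + (\<Sum>j<r i. u (i, j))"
  by (simp add: conormal_def pairing_lift sum_over_group)

text \<open>The new coordinates cancel in the sum over a group. In terms of slacks: the slacks of
  group \<open>i\<close> add up to the slack of the \<open>i\<close>-th core inequality at the base point.\<close>

lemma group_sum:
  assumes i: "i \<in> I" and z: "z \<in> Rspace total_dim"
  shows "(\<Sum>j\<le>r i. pairing total_dim (conormal (i, j)) z) = pairing n (a i) (base z)"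
proof -
  have "(\<Sum>j\<le>r i. pairing total_dim (conormal (i, j)) (lift (base z) (fibre z))) =
      (\<Sum>j<r i. - fibre z (i, j)) + pairing n (a i) (base z) + (\<Sum>j<r i. fibre z (i, j))"
    using i by (simp add: lessThan_Suc_atMost[symmetric] pairing_conormal_top pairing_conormal_low fibre_labels_def)
  then show ?thesis by (simp add: lift_base_fibre[OF z] sum_negf)
qed

text \<open>Apart from \<open>group_sum\<close> there is no relation between the base point and the values of the
  conormals. Points and directions of the expansion are constructed from this lemma.\<close>

lemma prescribed_values:
  assumes x: "x \<in> Rspace n" and t: "\<And>i. i \<in> I \<Longrightarrow> (\<Sum>j\<le>r i. t (i, j)) = pairing n (a i) x"
  shows "\<exists>z\<in>Rspace total_dim. base z = x \<and> (\<forall>k\<in>labels. pairing total_dim (conormal k) z = t k)"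
proof (intro bexI[of _ "lift x (\<lambda>p. - t p)"] conjI ballI)
  show "lift x (\<lambda>p. - t p) \<in> Rspace total_dim" by (rule lift_Rspace)
  show "base (lift x (\<lambda>p. - t p)) = x" by (rule base_lift[OF x])
  fix k assume "k \<in> labels"
  then obtain i j where k: "k = (i, j)" "i \<in> I" "j \<le> r i" by (auto simp: labels_def)
  show "pairing total_dim (conormal k) (lift x (\<lambda>p. - t p)) = t k"
  proof (cases "j < r i")
    case True
    then have "(i, j) \<in> fibre_labels" using k by (simp add: fibre_labels_def)
    then show ?thesis by (simp add: k(1) pairing_conormal_low)
  next
    case False
    then have j: "j = r i" using k by simp
    have "(\<Sum>j<r i. t (i, j)) + t (i, r i) = pairing n (a i) x"
      using t[OF k(2)] by (simp add: lessThan_Suc_atMost[symmetric])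
    then show ?thesis by (simp add: k(1) j pairing_conormal_top[OF k(2)] sum_negf)
  qed
qed

lemma zero_from_values:
  assumes z: "z \<in> Rspace total_dim" and b: "base z = 0" and A0: "\<And>k. k \<in> labels \<Longrightarrow> pairing total_dim (conormal k) z = 0"
  shows "z = 0"
proof -
  have "fibre z p = 0" if p: "p \<in> fibre_labels" for p
  proof -
    obtain i j where ij: "p = (i, j)" by (cases p)
    have "pairing total_dim (conormal (i, j)) (lift (base z) (fibre z)) = - fibre z (i, j)"
      using p unfolding ij by (rule pairing_conormal_low)
    moreover have "pairing total_dim (conormal (i, j)) z = 0" using A0 p fibre_labels_subset ij by auto
    ultimately show ?thesis by (simp add: lift_base_fibre[OF z] ij)
  qed
  then have "lift (base z) (fibre z) = 0" unfolding b by (rule lift_0)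
  then show ?thesis by (simp add: lift_base_fibre[OF z])
qed

lemma base_in_core:
  assumes z: "z \<in> expansion" shows "base z \<in> core_polytope"
  unfolding hpoly_def
proof (intro CollectI conjI ballI)
  fix i assume i: "i \<in> I"
  have zR: "z \<in> Rspace total_dim" using z by (simp add: hpoly_def)
  have "(\<Sum>j\<le>r i. pairing total_dim (conormal (i, j)) z) \<le> (\<Sum>j\<le>r i. 1)"
    using z i by (intro sum_mono) (auto simp: hpoly_def labels_def)
  then show "pairing n (a i) (base z) \<le> 1 + real (r i)"
    by (simp add: group_sum[OF i zR])
qed (rule base_Rspace)

text \<open>Nonnegative slacks vanish together exactly when their sum does.\<close>

lemma core_active_iff:
  assumes z: "z \<in> expansion" and i: "i \<in> I"
  shows "i \<in> core_active (base z) \<longleftrightarrow> (\<forall>j\<le>r i. (i, j) \<in> exp_active z)"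
proof -
  have zR: "z \<in> Rspace total_dim" using z by (simp add: hpoly_def)
  have nonneg: "0 \<le> 1 - pairing total_dim (conormal (i, j)) z" if "j \<le> r i" for j
    using z i that by (simp add: hpoly_def labels_def)
  have "(\<Sum>j\<le>r i. 1 - pairing total_dim (conormal (i, j)) z) = 1 + real (r i) - pairing n (a i) (base z)"
    by (simp add: sum_subtractf group_sum[OF i zR])
  then have "i \<in> core_active (base z) \<longleftrightarrow> (\<Sum>j\<le>r i. 1 - pairing total_dim (conormal (i, j)) z) = 0"
    using i by (auto simp: active_def)
  also have "\<dots> \<longleftrightarrow> (\<forall>j\<in>{..r i}. 1 - pairing total_dim (conormal (i, j)) z = 0)"
    using nonneg by (intro sum_nonneg_eq_0_iff) auto
  finally show ?thesis using i by (auto simp: active_def labels_def)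
qed

text \<open>In group \<open>i\<close>, the inequality \<open>c i\<close> takes all the slack. This is the point over \<open>x\<close> given
  by one vertex of each simplex.\<close>

lemma point_over:
  assumes x: "x \<in> core_polytope" and c: "\<And>i. i \<in> I \<Longrightarrow> c i \<le> r i"
  shows "\<exists>z\<in>expansion. base z = x \<and> (\<forall>i\<in>I. \<forall>j\<le>r i. j \<noteq> c i \<longrightarrow> (i, j) \<in> exp_active z)"
proof -
  define t where "t = (\<lambda>(i, j). if j = c i then pairing n (a i) x - real (r i) else 1)"
  have xR: "x \<in> Rspace n" using x by (simp add: hpoly_def)
  have tsum: "(\<Sum>j\<le>r i. t (i, j)) = pairing n (a i) x" if i: "i \<in> I" for i
  proof -
    have "(\<Sum>j\<le>r i. t (i, j)) = (\<Sum>j\<le>r i. 1 + (if j = c i then pairing n (a i) x - real (r i) - 1 else 0))"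
      by (rule sum.cong) (auto simp: t_def)
    then show ?thesis using c[OF i] by (simp add: sum.distrib)
  qed
  obtain z where z: "z \<in> Rspace total_dim" "base z = x \<and> (\<forall>k\<in>labels. pairing total_dim (conormal k) z = t k)"
    using prescribed_values[OF xR tsum] by (rule bexE)
  have "t k \<le> 1" if "k \<in> labels" for k
    using that x by (force simp: t_def labels_def hpoly_def)
  then have "z \<in> expansion" using z by (simp add: hpoly_def)
  moreover have "(i, j) \<in> exp_active z" if "i \<in> I" "j \<le> r i" "j \<noteq> c i" for i j
    using that z by (auto simp: active_def labels_def t_def)
  ultimately show ?thesis using z by (intro bexI[of _ z] conjI) simp_all
qed

text \<open>Otherwise slack could be moved between the two inequalities, in both directions.\<close>

lemma vertex_inactive_unique:
  assumes z: "z extreme_point_of expansion" and i: "i \<in> I" and j: "j \<le> r i" "j' \<le> r i" "j \<noteq> j'"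
    and inact: "(i, j) \<notin> exp_active z"
  shows "(i, j') \<in> exp_active z"
proof (rule ccontr)
  assume inact': "(i, j') \<notin> exp_active z"
  define t where "t = (\<lambda>k. if k = (i, j) then 1 else if k = (i, j') then - 1 else (0::real))"
  have tsum: "(\<Sum>l\<le>r i'. t (i', l)) = pairing n (a i') 0" if "i' \<in> I" for i'
  proof (cases "i' = i")
    case True
    have "(\<Sum>l\<le>r i'. t (i', l)) = (\<Sum>l\<le>r i. (if l = j then 1 else 0) + (if l = j' then - 1 else 0))"
      unfolding True by (rule sum.cong) (use j(3) in \<open>auto simp: t_def\<close>)
    then show ?thesis using j by (simp add: sum.distrib pairing_zero_right)
  qed (simp add: t_def pairing_zero_right)
  obtain d where d: "d \<in> Rspace total_dim" "base d = 0 \<and> (\<forall>k\<in>labels. pairing total_dim (conormal k) d = t k)"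
    using prescribed_values[OF Rspace_closed(4) tsum] by (rule bexE)
  have "\<forall>k\<in>exp_active z. pairing total_dim (conormal k) d = 0"
  proof
    fix k assume k: "k \<in> exp_active z"
    then have "k \<noteq> (i, j)" "k \<noteq> (i, j')" "k \<in> labels" using inact inact' by (auto simp: active_def)
    then show "pairing total_dim (conormal k) d = 0" using d(2) by (simp add: t_def)
  qed
  then have "d = 0"
    using z d(1) unfolding extreme_point_hpoly_iff[OF finite_labels] by simp
  moreover have "pairing total_dim (conormal (i, j)) d = 1" using d(2) i j by (simp add: t_def labels_def)
  ultimately show False by (simp add: pairing_zero_right)
qed

lemma vertex_choice:
  assumes z: "z extreme_point_of expansion"
  shows "\<exists>c. \<forall>i\<in>I. c i \<le> r i \<and> (\<forall>j\<le>r i. j \<noteq> c i \<longrightarrow> (i, j) \<in> exp_active z)"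
proof (rule bchoice, rule ballI)
  fix i assume i: "i \<in> I"
  show "\<exists>c. c \<le> r i \<and> (\<forall>j\<le>r i. j \<noteq> c \<longrightarrow> (i, j) \<in> exp_active z)"
  proof (cases "\<exists>c\<le>r i. (i, c) \<notin> exp_active z")
    case True
    then obtain c where c: "c \<le> r i" "(i, c) \<notin> exp_active z" by blast
    have "\<forall>j\<le>r i. j \<noteq> c \<longrightarrow> (i, j) \<in> exp_active z"
      using vertex_inactive_unique[OF z i c(1) _ _ c(2)] by simp
    then show ?thesis using c(1) by blast
  next
    case False
    then show ?thesis by (intro exI[of _ 0]) simp
  qed
qed

text \<open>A direction \<open>d\<close> of the base that respects the active core inequalities lifts to one that
  respects the active inequalities at \<open>z\<close>: in each group, the change of slack caused by \<open>d\<close> is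
  absorbed by the inequality that carries the slack.\<close>

lemma base_of_vertex:
  assumes z: "z extreme_point_of expansion" shows "base z extreme_point_of core_polytope"
  unfolding core.vertex_iff
proof (intro conjI ballI impI)
  have zE: "z \<in> expansion" using z by (simp add: extreme_point_of_def)
  then show "base z \<in> core_polytope" by (rule base_in_core)
  fix d assume d: "d \<in> Rspace n" "\<forall>i\<in>core_active (base z). pairing n (a i) d = 0"
  obtain c where c: "\<forall>i\<in>I. c i \<le> r i \<and> (\<forall>j\<le>r i. j \<noteq> c i \<longrightarrow> (i, j) \<in> exp_active z)"
    using vertex_choice[OF z] by (rule exE)
  define t where "t = (\<lambda>(i, j). if j = c i then pairing n (a i) d else 0)"
  have tsum: "(\<Sum>j\<le>r i. t (i, j)) = pairing n (a i) d" if "i \<in> I" for i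
    using c that by (simp add: t_def)
  obtain D where D: "D \<in> Rspace total_dim" "base D = d \<and> (\<forall>k\<in>labels. pairing total_dim (conormal k) D = t k)"
    using prescribed_values[OF d(1) tsum] by (rule bexE)
  have "\<forall>k\<in>exp_active z. pairing total_dim (conormal k) D = 0"
  proof
    fix k assume k: "k \<in> exp_active z"
    then have kK: "k \<in> labels" by (simp add: active_def)
    then obtain i j where ij: "k = (i, j)" "i \<in> I" "j \<le> r i" by (auto simp: labels_def)
    have "t k = 0"
    proof (cases "j = c i")
      case True
      have "\<forall>j\<le>r i. (i, j) \<in> exp_active z"
      proof (intro allI impI)
        fix j' assume "j' \<le> r i"
        then show "(i, j') \<in> exp_active z"
          using c ij k True by (cases "j' = c i") simp_all
      qed
      then have "i \<in> core_active (base z)" using core_active_iff[OF zE ij(2)] by simp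
      then show ?thesis using d(2) ij by (simp add: t_def)
    qed (simp add: t_def ij)
    then show "pairing total_dim (conormal k) D = 0" using D(2) kK by simp
  qed
  then have "D = 0" using z D(1) unfolding extreme_point_hpoly_iff[OF finite_labels] by simp
  then have "base D = 0" by (simp add: base_def fun_eq_iff)
  then show "d = 0" using D(2) by simp
qed

lemma card_labels: "card labels = card fibre_labels + card I"
proof -
  have "card labels = (\<Sum>i\<in>I. r i + 1)" unfolding labels_def using core.finite_index by simp
  also have "\<dots> = card fibre_labels + card I"
    unfolding fibre_labels_def using core.finite_index by (simp add: sum.distrib sum_Suc)
  finally show ?thesis .
qed

text \<open>Each of the facets of the core that misses the vertex \<open>base z\<close>, all but \<open>n\<close> of them, has
  an inactive inequality in its group.\<close>

lemma card_exp_active_le: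
  assumes z: "z extreme_point_of expansion" shows "card (exp_active z) \<le> total_dim"
proof -
  have zE: "z \<in> expansion" using z by (simp add: extreme_point_of_def)
  obtain c where c: "\<forall>i\<in>I. c i \<le> r i \<and> (\<forall>j\<le>r i. j \<noteq> c i \<longrightarrow> (i, j) \<in> exp_active z)"
    using vertex_choice[OF z] by (rule exE)
  let ?N = "I - core_active (base z)"
  let ?M = "(\<lambda>i. (i, c i)) ` ?N"
  have MK: "?M \<subseteq> labels" using c by (auto simp: labels_def)
  have "exp_active z \<subseteq> labels - ?M"
  proof
    fix k assume k: "k \<in> exp_active z"
    have "k \<notin> ?M"
    proof
      assume "k \<in> ?M"
      then obtain i where i: "i \<in> I" "i \<notin> core_active (base z)" "k = (i, c i)" by auto
      have "\<forall>j\<le>r i. (i, j) \<in> exp_active z"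
      proof (intro allI impI)
        fix j assume "j \<le> r i"
        then show "(i, j) \<in> exp_active z" using c i k by (cases "j = c i") simp_all
      qed
      then show False using core_active_iff[OF zE i(1)] i(2) by simp
    qed
    then show "k \<in> labels - ?M" using k by (simp add: active_def)
  qed
  then have "card (exp_active z) \<le> card (labels - ?M)" using finite_labels by (intro card_mono) auto
  also have "\<dots> = card labels - card ?N"
    using MK finite_subset[OF MK finite_labels]
    by (simp add: card_Diff_subset card_image inj_on_def)
  also have "card ?N = card I - n"
    using core.card_act_vertex[OF base_of_vertex[OF z]] core.finite_act core.act_subset
    by (simp add: card_Diff_subset)
  also have "card labels - (card I - n) \<le> total_dim" by (simp add: card_labels total_dim_def)
  finally show ?thesis .
qed

definition fibre_unit :: "'i \<times> nat \<Rightarrow> nat \<Rightarrow> real" where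
  "fibre_unit p = lift 0 (\<lambda>q. if q = p then 1 else 0)"

lemma lift_expand: "lift x u = lift x (\<lambda>_. 0) + (\<Sum>p\<in>fibre_labels. u p *\<^sub>R fibre_unit p)"
proof -
  have "(\<Sum>p\<in>fibre_labels. u p *\<^sub>R fibre_unit p) = lift (\<Sum>p\<in>fibre_labels. u p *\<^sub>R 0) (\<lambda>q. \<Sum>p\<in>fibre_labels. u p * (if q = p then 1 else 0))"
    unfolding fibre_unit_def lift_scale[symmetric] lift_sum by (rule refl)
  also have "\<dots> = lift 0 u"
    using finite_fibre_labels by (simp add: if_distrib cong: if_cong) (rule lift_cong, simp)
  finally show ?thesis
    using lift_add[of x 0 "\<lambda>_. 0" u] by simp
qed

lemma conormal_low: "(i, j) \<in> fibre_labels \<Longrightarrow> conormal (i, j) = - fibre_unit (i, j)"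
  using lift_scale[of "-1" 0 "\<lambda>q. if q = (i, j) then 1 else 0"]
  by (simp add: conormal_def fibre_unit_def fibre_labels_def if_distrib cong: if_cong)

lemma conormal_top: "i \<in> I \<Longrightarrow> conormal (i, r i) = lift (a i) (\<lambda>_. 0) + (\<Sum>j<r i. fibre_unit (i, j))"
proof -
  assume i: "i \<in> I"
  have "conormal (i, r i) = lift (a i) (\<lambda>_. 0) + (\<Sum>p\<in>fibre_labels. (if fst p = i then 1 else 0) *\<^sub>R fibre_unit p)"
    by (simp add: conormal_def lift_expand[of "a i" "\<lambda>q. if fst q = i then 1 else 0"])
  also have "(\<Sum>p\<in>fibre_labels. (if fst p = i then 1 else 0) *\<^sub>R fibre_unit p) = (\<Sum>p\<in>fibre_labels. if fst p = i then fibre_unit p else 0)"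
    by (rule sum.cong) auto
  also have "\<dots> = (\<Sum>p\<in>{p \<in> fibre_labels. fst p = i}. fibre_unit p)"
    using finite_fibre_labels by (simp add: sum.inter_filter)
  also have "{p \<in> fibre_labels. fst p = i} = Pair i ` {..<r i}" using i by (auto simp: fibre_labels_def)
  also have "(\<Sum>p\<in>Pair i ` {..<r i}. fibre_unit p) = (\<Sum>j<r i. fibre_unit (i, j))"
    by (subst sum.reindex) (auto simp: inj_on_def)
  finally show ?thesis .
qed

text \<open>If facet \<open>i\<close> passes through the base vertex, then the whole group is active, and the
  conormals of its new coordinates can be added to its last conormal, which leaves \<open>a i\<close>. These
  vectors generate the lattice of the base, since the core is smooth. For the other groups only
  the coordinate that belongs to the inactive inequality is not among the conormals; it is
  recovered from the last conormal of the group by subtracting \<open>a i\<close> and the other coordinates.\<close>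

lemma conormals_generate:
  assumes z: "z extreme_point_of expansion"
  shows "Zlattice total_dim \<subseteq> zspan (conormal ` exp_active z)"
proof -
  let ?Z = "zspan (conormal ` exp_active z)"
  have zE: "z \<in> expansion" using z by (simp add: extreme_point_of_def)
  have fin: "finite (conormal ` exp_active z)" using finite_labels by (simp add: active_def)
  have conormal_in: "conormal k \<in> ?Z" if "k \<in> exp_active z" for k
    using that by (intro zspan_base[OF fin]) simp
  have fibre_unit_in: "fibre_unit (i, j) \<in> ?Z" if "(i, j) \<in> exp_active z" "i \<in> I" "j < r i" for i j
  proof -
    have "fibre_unit (i, j) = of_int (-1) *\<^sub>R conormal (i, j)" using that by (simp add: conormal_low fibre_labels_def)
    then show ?thesis using zspan_scale[OF conormal_in[OF that(1)], of "-1"] by simp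
  qed
  have base_gen: "lift (a i) (\<lambda>_. 0) \<in> ?Z" if i: "i \<in> core_active (base z)" for i
  proof -
    have iI: "i \<in> I" using i by (simp add: active_def)
    have all: "(i, j) \<in> exp_active z" if "j \<le> r i" for j
      using core_active_iff[OF zE iI] i that by simp
    have "lift (a i) (\<lambda>_. 0) = conormal (i, r i) - (\<Sum>j<r i. fibre_unit (i, j))" by (simp add: conormal_top[OF iI])
    also have "\<dots> \<in> ?Z"
      by (intro zspan_diff conormal_in all zspan_sum fibre_unit_in iI) simp_all
    finally show ?thesis .
  qed
  have horizontal: "lift x (\<lambda>_. 0) \<in> ?Z" if x: "x \<in> Zlattice n" for x
  proof -
    let ?B = "a ` core_active (base z)"
    have "x \<in> zspan ?B"
      using lattice_basis_zspan[OF core.basis_at_vertex[OF base_of_vertex[OF z]]] x by (rule subsetD)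
    then obtain c :: "(nat \<Rightarrow> real) \<Rightarrow> int" where c: "x = (\<Sum>b\<in>?B. of_int (c b) *\<^sub>R b)"
      unfolding zspan_def by (elim CollectE exE)
    have "lift x (\<lambda>_. 0) = lift (\<Sum>b\<in>?B. of_int (c b) *\<^sub>R b) (\<lambda>p. \<Sum>b\<in>?B. of_int (c b) * 0)"
      using c by simp
    also have "\<dots> = (\<Sum>b\<in>?B. of_int (c b) *\<^sub>R lift b (\<lambda>_. 0))"
      unfolding lift_sum lift_scale by (rule refl)
    also have "\<dots> \<in> ?Z"
    proof (intro zspan_sum zspan_scale)
      fix b assume "b \<in> ?B"
      then obtain i where "i \<in> core_active (base z)" "b = a i" by (elim imageE)
      then show "lift b (\<lambda>_. 0) \<in> ?Z" using base_gen by simp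
    qed
    finally show ?thesis .
  qed
  have vertical: "fibre_unit p \<in> ?Z" if p: "p \<in> fibre_labels" for p
  proof -
    obtain i j where ij: "p = (i, j)" "i \<in> I" "j < r i" using p by (auto simp: fibre_labels_def)
    show ?thesis
    proof (cases "(i, j) \<in> exp_active z")
      case True
      then show ?thesis using fibre_unit_in ij by simp
    next
      case False
      have others: "(i, j') \<in> exp_active z" if "j' \<le> r i" "j' \<noteq> j" for j'
        using vertex_inactive_unique[OF z ij(2) _ that(1) _ False] that ij by simp
      have "(\<Sum>j<r i. fibre_unit (i, j)) = fibre_unit (i, j) + (\<Sum>j'\<in>{..<r i} - {j}. fibre_unit (i, j'))"
        using ij by (simp add: sum.remove[of _ j])
      then have "fibre_unit (i, j) = conormal (i, r i) - lift (a i) (\<lambda>_. 0) - (\<Sum>j'\<in>{..<r i} - {j}. fibre_unit (i, j'))"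
        by (simp add: conormal_top[OF ij(2)])
      also have "\<dots> \<in> ?Z"
        using ij
        by (intro zspan_diff conormal_in others zspan_sum fibre_unit_in horizontal core.conormal_Zlattice) simp_all
      finally show ?thesis by (simp add: ij(1))
    qed
  qed
  show ?thesis
  proof
    fix y assume y: "y \<in> Zlattice total_dim"
    have "\<forall>p\<in>fibre_labels. \<exists>c::int. fibre y p = of_int c"
    proof
      fix p show "\<exists>c::int. fibre y p = of_int c"
        using fibre_Zlattice(2)[OF y, of p] by (rule Ints_cases) (rule exI)
    qed
    then obtain c :: "'i \<times> nat \<Rightarrow> int" where c: "\<forall>p\<in>fibre_labels. fibre y p = of_int (c p)"
      by (rule bchoice[THEN exE])
    have "y = lift (base y) (fibre y)"
      using lift_base_fibre y Zlattice_imp_Rspace by simp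
    also have "\<dots> = lift (base y) (\<lambda>_. 0) + (\<Sum>p\<in>fibre_labels. of_int (c p) *\<^sub>R fibre_unit p)"
      unfolding lift_expand[of "base y" "fibre y"] using c by simp
    also have "\<dots> \<in> ?Z"
      by (intro zspan_add zspan_sum zspan_scale horizontal vertical fibre_Zlattice(1)[OF y])
    finally show "y \<in> ?Z" .
  qed
qed

lemma other_index: "i \<in> I \<Longrightarrow> (if j = 0 then 1 else 0) \<le> r i" "(if j = (0::nat) then 1 else 0) \<noteq> j"
  using r_pos[of i] by auto

text \<open>At a vertex the conormals generate a lattice of rank \<open>total_dim\<close>, and there are at most
  \<open>total_dim\<close> of them; hence they are distinct and form a basis.\<close>

sublocale expanded: smooth_presentation total_dim labels conormal "\<lambda>_. 1"
proof
  show "finite labels" by (rule finite_labels)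
  show "\<forall>d\<in>Rspace total_dim. (\<forall>k\<in>labels. pairing total_dim (conormal k) d \<le> 0) \<longrightarrow> d = 0"
  proof (intro ballI impI)
    fix d assume d: "d \<in> Rspace total_dim" "\<forall>k\<in>labels. pairing total_dim (conormal k) d \<le> 0"
    have le: "pairing total_dim (conormal (i, j)) d \<le> 0" if "i \<in> I" "j \<le> r i" for i j
      using d(2) that by (simp add: labels_def)
    have "pairing n (a i) (base d) \<le> 0" if i: "i \<in> I" for i
      unfolding group_sum[OF i d(1), symmetric] using le[OF i] by (intro sum_nonpos) simp
    then have b: "base d = 0" using core.no_recession base_Rspace by simp
    show "d = 0"
    proof (rule zero_from_values[OF d(1) b])
      fix k assume "k \<in> labels"
      then obtain i j where ij: "k = (i, j)" "i \<in> I" "j \<le> r i" by (auto simp: labels_def)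
      have "(\<Sum>j\<le>r i. - pairing total_dim (conormal (i, j)) d) = 0"
        unfolding sum_negf group_sum[OF ij(2) d(1)] b by (simp add: pairing_zero_right)
      then have "\<forall>j\<in>{..r i}. - pairing total_dim (conormal (i, j)) d = 0"
        using le[OF ij(2)] by (subst (asm) sum_nonneg_eq_0_iff) auto
      then show "pairing total_dim (conormal k) d = 0" using ij by simp
    qed
  qed
  show "\<exists>x\<in>expansion. pairing total_dim (conormal k) x = 1" if k: "k \<in> labels" for k
  proof -
    obtain i j where ij: "k = (i, j)" "i \<in> I" "j \<le> r i" using k by (auto simp: labels_def)
    obtain x where x: "x \<in> core_polytope" using core.hpoly_nonempty by auto
    obtain z where z: "z \<in> expansion" "base z = x \<and>
        (\<forall>i\<in>I. \<forall>j'\<le>r i. j' \<noteq> (if j = 0 then 1 else 0) \<longrightarrow> (i, j') \<in> exp_active z)"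
      using point_over[OF x, of "\<lambda>_. if j = 0 then 1 else 0", OF other_index(1)] by (rule bexE)
    have "(i, j) \<in> exp_active z" using z(2) ij other_index(2)[of j] by auto
    then show ?thesis using z(1) ij by (intro bexI[of _ z]) (simp_all add: active_def)
  qed
  fix z assume z: "z extreme_point_of expansion"
  have fin: "finite (exp_active z)" using finite_labels by (simp add: active_def)
  have le: "card (conormal ` exp_active z) \<le> total_dim"
    using card_image_le[OF fin, of conormal] card_exp_active_le[OF z] by simp
  have "conormal ` exp_active z \<subseteq> Zlattice total_dim"
    using conormal_Zlattice_labels by (auto simp: active_def)
  then show basis: "lattice_basis total_dim (conormal ` exp_active z)"
    using fin le conormals_generate[OF z] by (intro lattice_basisI_generating) simp_all
  have "card (conormal ` exp_active z) = card (exp_active z)"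
    using lattice_basis_card[OF basis] card_exp_active_le[OF z] card_image_le[OF fin, of conormal] by simp
  then show "inj_on conormal (exp_active z)" using fin by (intro eq_card_imp_inj_on)
qed

text \<open>Facets of the same group meet over the corresponding facet of the core. For facets of
  different groups, let in both groups an inequality other than the given one carry the slack.\<close>

lemma facets_pervasive:
  assumes F: "is_facet expansion F" shows "is_pervasive expansion F"
  unfolding is_pervasive_def
proof (intro allI impI)
  fix G assume G: "is_facet expansion G \<and> G \<noteq> F"
  obtain k where k: "k \<in> labels" "F = exp_face {k}"
    using F unfolding expanded.is_facet_iff by (rule bexE)
  obtain k' where k': "k' \<in> labels" "G = exp_face {k'}"
    using conjunct1[OF G] unfolding expanded.is_facet_iff by (rule bexE)
  obtain i j where ij: "k = (i, j)" "i \<in> I" "j \<le> r i" using k(1) by (auto simp: labels_def)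
  obtain i' j' where ij': "k' = (i', j')" "i' \<in> I" "j' \<le> r i'" using k'(1) by (auto simp: labels_def)
  have "\<exists>z\<in>expansion. k \<in> exp_active z \<and> k' \<in> exp_active z"
  proof (cases "i = i'")
    case True
    obtain x where x: "x \<in> core_polytope" "pairing n (a i) x = 1 + real (r i)"
      using core.attained[OF ij(2)] by (rule bexE)
    obtain z where z: "z \<in> expansion"
        "base z = x \<and> (\<forall>i\<in>I. \<forall>j\<le>r i. j \<noteq> 0 \<longrightarrow> (i, j) \<in> exp_active z)"
      using point_over[OF x(1), of "\<lambda>_. 0", OF le0] by (rule bexE)
    have "i \<in> core_active (base z)" using x z ij by (simp add: active_def)
    then have "\<forall>j\<le>r i. (i, j) \<in> exp_active z" using core_active_iff[OF z(1) ij(2)] by simp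
    then show ?thesis using z(1) ij ij' True by (intro bexI[of _ z]) simp_all
  next
    case False
    obtain x where x: "x \<in> core_polytope" using core.hpoly_nonempty by auto
    define c where "c l = (if l = i then if j = 0 then 1 else 0 else if j' = 0 then 1 else (0::nat))" for l
    have c: "c l \<le> r l" if "l \<in> I" for l using r_pos[OF that] by (auto simp: c_def)
    obtain z where z: "z \<in> expansion"
        "base z = x \<and> (\<forall>i\<in>I. \<forall>j\<le>r i. j \<noteq> c i \<longrightarrow> (i, j) \<in> exp_active z)"
      using point_over[OF x c] by (rule bexE)
    have "j \<noteq> c i" "j' \<noteq> c i'" using False by (auto simp: c_def)
    then show ?thesis using z ij ij' by (intro bexI[of _ z]) simp_all
  qed
  then obtain z where z: "z \<in> expansion" "k \<in> exp_active z \<and> k' \<in> exp_active z" by (rule bexE)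
  have "z \<in> F" "z \<in> G"
    using z expanded.in_hf_iff[OF z(1) k(1)] expanded.in_hf_iff[OF z(1) k'(1)] k(2) k'(2) by simp_all
  then show "F \<inter> G \<noteq> {}" by auto
qed

text \<open>At a vertex off the facet \<open>(i, j)\<close> the inequality \<open>(i, j)\<close> carries all the slack of its
  group. Dropping another active inequality \<open>(i, j')\<close> of the group leaves an edge, and
  transferring the slack from \<open>(i, j)\<close> to \<open>(i, j')\<close> gives a point of this edge on the facet.\<close>

lemma facets_powerful:
  assumes F: "is_facet expansion F" shows "is_powerful expansion F"
  unfolding is_powerful_def
proof (intro allI impI)
  fix v assume v: "v extreme_point_of expansion \<and> v \<notin> F"
  then have ext: "v extreme_point_of expansion" and vE: "v \<in> expansion"
    by (simp_all add: extreme_point_of_def)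
  have vR: "v \<in> Rspace total_dim" using vE by (simp add: hpoly_def)
  obtain k where k: "k \<in> labels" "F = exp_face {k}"
    using F unfolding expanded.is_facet_iff by (rule bexE)
  obtain i j where ij: "k = (i, j)" "i \<in> I" "j \<le> r i" using k(1) by (auto simp: labels_def)
  have inact: "(i, j) \<notin> exp_active v"
    using v expanded.in_hf_iff[OF vE k(1)] k(2) ij(1) by simp
  define j' where "j' = (if j = 0 then 1 else (0::nat))"
  have j': "j' \<le> r i" "j \<noteq> j'" using other_index(1)[OF ij(2), of j] by (auto simp: j'_def)
  have act': "(i, j') \<in> exp_active v"
    by (rule vertex_inactive_unique[OF ext ij(2,3) j'(1,2) inact])
  define T where "T = exp_active v - {(i, j')}"
  have TK: "T \<subseteq> exp_active v" by (auto simp: T_def)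
  have "card T + 1 = total_dim"
    using expanded.card_act_vertex[OF ext] act' expanded.finite_act[of v]
    by (metis T_def Suc_eq_plus1 card.remove)
  then have edge: "is_edge expansion (exp_face T)"
    by (rule expanded.is_edge_hf[OF ext TK])
  have vT: "v \<in> exp_face T" using vE TK by (auto simp: hface_def active_def)
  define \<delta> where "\<delta> = 1 - pairing total_dim (conormal (i, j)) v"
  have \<delta>: "\<delta> \<ge> 0" using vE k(1) ij by (simp add: \<delta>_def hpoly_def)
  define t where "t = (\<lambda>q. if q = (i, j) then \<delta> else if q = (i, j') then - \<delta> else (0::real))"
  have tsum: "(\<Sum>l\<le>r i'. t (i', l)) = pairing n (a i') 0" if "i' \<in> I" for i'
  proof (cases "i' = i")
    case True
    have "(\<Sum>l\<le>r i'. t (i', l)) = (\<Sum>l\<le>r i. (if l = j then \<delta> else 0) + (if l = j' then - \<delta> else 0))"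
      unfolding True by (rule sum.cong) (use j'(2) in \<open>auto simp: t_def\<close>)
    then show ?thesis using j' ij by (simp add: sum.distrib pairing_zero_right)
  qed (simp add: t_def pairing_zero_right)
  obtain d where d: "d \<in> Rspace total_dim" "base d = 0 \<and> (\<forall>q\<in>labels. pairing total_dim (conormal q) d = t q)"
    using prescribed_values[OF Rspace_closed(4) tsum] by (rule bexE)
  have val: "pairing total_dim (conormal q) (v + d) = pairing total_dim (conormal q) v + t q" if "q \<in> labels" for q
    using d(2) that by (simp add: pairing_add_right)
  have wE: "v + d \<in> expansion"
    unfolding hpoly_def
  proof (intro CollectI conjI ballI)
    show "v + d \<in> Rspace total_dim" by (rule Rspace_closed(1)[OF vR d(1)])
    fix q assume q: "q \<in> labels"
    then have "pairing total_dim (conormal q) v \<le> 1" using vE by (simp add: hpoly_def)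
    then show "pairing total_dim (conormal q) (v + d) \<le> 1"
      using \<delta> by (auto simp: val[OF q] t_def \<delta>_def)
  qed
  have sub: "insert (i, j) T \<subseteq> exp_active (v + d)"
  proof
    fix q assume q: "q \<in> insert (i, j) T"
    then have qK: "q \<in> labels" using k(1) ij(1) by (auto simp: T_def active_def)
    have "pairing total_dim (conormal q) v + t q = 1"
      using q inact by (auto simp: t_def \<delta>_def T_def active_def)
    then show "q \<in> exp_active (v + d)" using qK val[OF qK] by (simp add: active_def)
  qed
  \<comment> \<open>The point \<open>v + d\<close> is itself the other end of the edge, but it is enough that some vertex lies
    on all facets through it.\<close>
  obtain w where w: "w extreme_point_of expansion" "exp_active (v + d) \<subseteq> exp_active w"
    by (rule expanded.vertex_beyond[OF wE])
  have wE: "w \<in> expansion" using w(1) by (simp add: extreme_point_of_def)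
  have act_w: "insert (i, j) T \<subseteq> exp_active w" using sub w(2) by (rule order_trans)
  have "w \<in> exp_face T" using wE act_w by (auto simp: hface_def active_def)
  moreover have "w \<in> F" using expanded.in_hf_iff[OF wE k(1)] act_w k(2) ij(1) by simp
  ultimately show "\<exists>e w. is_edge expansion e \<and> v \<in> e \<and> w extreme_point_of expansion \<and> w \<in> F \<and> w \<in> e"
    using edge vT w(1) by (intro exI[of _ "exp_face T"] exI[of _ w] conjI)
qed

definition offset :: "nat \<Rightarrow> real" where "offset = lift 0 (\<lambda>_. - 1)"

lemma core_face: "exp_face fibre_labels = (\<lambda>x. offset + x) ` core_polytope"
proof -
  have shift: "offset + x = lift x (\<lambda>_. - 1)" if "x \<in> Rspace n" for x
    using that by (auto simp: offset_def lift_def fun_eq_iff Rspace_def total_dim_def)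
  show ?thesis
  proof
    show "exp_face fibre_labels \<subseteq> (\<lambda>x. offset + x) ` core_polytope"
    proof
      fix z assume z: "z \<in> exp_face fibre_labels"
      then have zE: "z \<in> expansion" by (simp add: hface_def)
      then have zR: "z \<in> Rspace total_dim" by (simp add: hpoly_def)
      have "fibre z p = - 1" if p: "p \<in> fibre_labels" for p
      proof -
        obtain i j where ij: "p = (i, j)" by (cases p)
        have "pairing total_dim (conormal (i, j)) (lift (base z) (fibre z)) = - fibre z (i, j)"
          using p unfolding ij by (rule pairing_conormal_low)
        moreover have "pairing total_dim (conormal (i, j)) z = 1" using z p ij by (simp add: hface_def)
        ultimately show ?thesis by (simp add: lift_base_fibre[OF zR] ij)
      qed
      then have "lift (base z) (fibre z) = lift (base z) (\<lambda>_. - 1)" by (rule lift_cong)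
      then have "z = offset + base z" by (simp add: lift_base_fibre[OF zR] shift[OF base_Rspace])
      then show "z \<in> (\<lambda>x. offset + x) ` core_polytope"
        using base_in_core[OF zE] by (rule image_eqI)
    qed
    show "(\<lambda>x. offset + x) ` core_polytope \<subseteq> exp_face fibre_labels"
    proof
      fix z assume "z \<in> (\<lambda>x. offset + x) ` core_polytope"
      then obtain x where x: "z = offset + x" "x \<in> core_polytope" by (rule imageE)
      have z: "z = lift x (\<lambda>_. - 1)" using x by (simp add: shift hpoly_def)
      have low: "pairing total_dim (conormal (i, j)) z = 1" if "(i, j) \<in> fibre_labels" for i j
        unfolding z by (simp add: pairing_conormal_low[OF that])
      have high: "pairing total_dim (conormal (i, r i)) z \<le> 1" if "i \<in> I" for i
      proof -
        have "pairing n (a i) x \<le> 1 + real (r i)" using x(2) that by (simp add: hpoly_def)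
        then show ?thesis unfolding z by (simp add: pairing_conormal_top[OF that])
      qed
      have "pairing total_dim (conormal k) z \<le> 1" if k: "k \<in> labels" for k
      proof -
        obtain i j where ij: "k = (i, j)" "i \<in> I" "j \<le> r i" using k by (auto simp: labels_def)
        show ?thesis
        proof (cases "j < r i")
          case True
          then show ?thesis using low[of i j] ij by (simp add: fibre_labels_def)
        next
          case False
          then show ?thesis using high[OF ij(2)] ij by simp
        qed
      qed
      then have "z \<in> expansion" using z lift_Rspace by (simp add: hpoly_def)
      then show "z \<in> exp_face fibre_labels" using low by (auto simp: hface_def)
    qed
  qed
qed

end

section \<open>Integral polytopes and their multiples\<close>

lemma hpoly_dilate:
  assumes k: "k > 0" and x0: "x0 \<in> Rspace n"
    and b': "\<forall>i\<in>I. b' i = k * b i - pairing n (a i) x0"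
  shows "hpoly n I a b' = (\<lambda>\<xi>. k *\<^sub>R \<xi> - x0) ` hpoly n I a b"
    and "active n I a b' (k *\<^sub>R \<xi> - x0) = active n I a b \<xi>"
proof -
  have mem: "k *\<^sub>R \<xi> - x0 \<in> hpoly n I a b' \<longleftrightarrow> \<xi> \<in> hpoly n I a b" if "\<xi> \<in> Rspace n" for \<xi>
    using k that x0 by (simp add: hpoly_def b' pairing_right Rspace_closed)
  show "hpoly n I a b' = (\<lambda>\<xi>. k *\<^sub>R \<xi> - x0) ` hpoly n I a b"
  proof
    show "(\<lambda>\<xi>. k *\<^sub>R \<xi> - x0) ` hpoly n I a b \<subseteq> hpoly n I a b'"
      using mem hpoly_subset_Rspace[of n I a b] by (auto simp: subset_iff)
    show "hpoly n I a b' \<subseteq> (\<lambda>\<xi>. k *\<^sub>R \<xi> - x0) ` hpoly n I a b"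
    proof
      fix y assume y: "y \<in> hpoly n I a b'"
      define \<xi> where "\<xi> = (1 / k) *\<^sub>R (y + x0)"
      have R: "\<xi> \<in> Rspace n"
        unfolding \<xi>_def using y x0 by (intro Rspace_closed) (auto simp: hpoly_def)
      have eq: "y = k *\<^sub>R \<xi> - x0" using k by (simp add: \<xi>_def)
      then have "\<xi> \<in> hpoly n I a b" using mem[OF R] y by simp
      then show "y \<in> (\<lambda>\<xi>. k *\<^sub>R \<xi> - x0) ` hpoly n I a b" unfolding eq by (rule imageI)
    qed
  qed
  show "active n I a b' (k *\<^sub>R \<xi> - x0) = active n I a b \<xi>"
    unfolding active_def using k by (auto simp: b' pairing_right)
qed

lemma smooth_presentation_dilate:
  assumes sp: "smooth_presentation n I a b" and k: "k > 0" and x0: "x0 \<in> Rspace n"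
    and b': "\<forall>i\<in>I. b' i = k * b i - pairing n (a i) x0"
  shows "smooth_presentation n I a b'"
proof -
  interpret smooth_presentation n I a b by (rule sp)
  note image = hpoly_dilate(1)[where b = b and b' = b' and a = a and I = I, OF k x0 b']
  note act_eq = hpoly_dilate(2)[where b = b and b' = b' and a = a and I = I, OF k x0 b']
  show ?thesis
  proof
    show "finite I" by (rule finite_index)
    show "\<forall>d\<in>Rspace n. (\<forall>i\<in>I. pairing n (a i) d \<le> 0) \<longrightarrow> d = 0" by (rule no_recession)
    show "\<exists>x\<in>hpoly n I a b'. pairing n (a i) x = b' i" if i: "i \<in> I" for i
    proof -
      obtain x where x: "x \<in> P" "pairing n (a i) x = b i" using attained[OF i] by (rule bexE)
      have "k *\<^sub>R x - x0 \<in> hpoly n I a b'"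
        unfolding image using x(1) by (rule imageI)
      then show ?thesis
        by (rule bexI[rotated]) (simp add: pairing_right bspec[OF b' i] x(2))
    qed
    fix v assume v: "v extreme_point_of hpoly n I a b'"
    then have v': "v \<in> hpoly n I a b'"
      and rigid: "\<forall>d\<in>Rspace n. (\<forall>i\<in>active n I a b' v. pairing n (a i) d = 0) \<longrightarrow> d = 0"
      unfolding extreme_point_hpoly_iff[OF finite_index] by simp_all
    obtain \<xi> where \<xi>: "v = k *\<^sub>R \<xi> - x0" "\<xi> \<in> P" using v' unfolding image by (rule imageE)
    have act: "active n I a b' v = act \<xi>" unfolding \<xi>(1) by (rule act_eq)
    have ext: "\<xi> extreme_point_of P" unfolding vertex_iff using \<xi>(2) rigid act by simp
    show "inj_on a (active n I a b' v)" unfolding act by (rule inj_at_vertex[OF ext])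
    show "lattice_basis n (a ` active n I a b' v)" unfolding act by (rule basis_at_vertex[OF ext])
  qed
qed

context smooth_presentation
begin

text \<open>Each summand is a nonnegative integer, because the facet contains an integral vertex, and
  not all of them vanish, because otherwise the facet would contain the hull of the vertices.\<close>

lemma vertex_slack_sum:
  assumes integral: "\<forall>v. v extreme_point_of P \<longrightarrow> v \<in> Zlattice n" and i: "i \<in> I"
  shows "\<exists>s::nat. 1 \<le> s \<and> (\<Sum>v | v extreme_point_of P. b i - pairing n (a i) v) = real s"
proof -
  let ?V = "{v. v extreme_point_of P}"
  let ?S = "\<Sum>v\<in>?V. b i - pairing n (a i) v"
  have int: "v \<in> Zlattice n" if "v extreme_point_of P" for v using integral that by simp
  have fin: "finite ?V" by (rule finite_extreme_points_hpoly[OF finite_index])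
  have nonneg: "0 \<le> b i - pairing n (a i) v" if "v \<in> ?V" for v
    using that i by (simp add: extreme_point_of_def hpoly_def)
  obtain w where w: "w extreme_point_of P" "i \<in> act w" using vertex_on_facet[OF i] .
  have aZ: "a i \<in> Zlattice n" by (rule conormal_Zlattice[OF i])
  have "b i = pairing n (a i) w" using w(2) by (simp add: active_def)
  then have "b i \<in> \<int>" using pairing_Ints[OF aZ int[OF w(1)]] by simp
  then have "?S \<in> \<int>" using pairing_Ints[OF aZ int] by (intro Ints_sum Ints_diff) simp_all
  then obtain s where s: "?S = of_int s" by (rule Ints_cases)
  have "?S > 0"
  proof (rule ccontr)
    assume "\<not> ?S > 0"
    then have "?S = 0" using sum_nonneg[of ?V "\<lambda>v. b i - pairing n (a i) v"] nonneg by simp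
    then have zero: "\<forall>v\<in>?V. b i - pairing n (a i) v = 0"
      using sum_nonneg_eq_0_iff[OF fin, of "\<lambda>v. b i - pairing n (a i) v"] nonneg by simp
    obtain y where y: "y \<in> P" "act y = {}" using point_with_active_set[OF w(1), of "{}"] by auto
    have yh: "y \<in> convex hull ?V" using y(1) hpoly_eq_hull by (simp only:)
    have "pairing n (- a i) y \<le> - b i"
      by (rule pairing_le_on_hull[OF _ yh]) (use zero in \<open>simp add: pairing_minus_left\<close>)
    then have "b i \<le> pairing n (a i) y" by (simp add: pairing_minus_left)
    moreover have "pairing n (a i) y \<le> b i" using y(1) i by (simp add: hpoly_def)
    ultimately have "i \<in> act y" using i by (simp add: active_def)
    then show False using y(2) by simp
  qed
  then have "s \<ge> 1" using s by simp
  then show ?thesis using s by (intro exI[of _ "nat s"]) simp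
qed

end

section \<open>The embedding as a face of a monotone polytope\<close>

theorem proposition1p10:
  fixes n :: nat and \<Delta>' :: "(nat \<Rightarrow> real) set"
  assumes "smooth_polytope n \<Delta>'"
    and "integral_vertices n \<Delta>'"
  shows "\<exists>k::nat. k > 0 \<and>
    (\<exists>m \<Delta> f. monotone_polytope m \<Delta> \<and>
       (\<forall>F. is_facet \<Delta> F \<longrightarrow> is_pervasive \<Delta> F \<and> is_powerful \<Delta> F) \<and>
       f face_of \<Delta> \<and>
       integrally_affine_equivalent n ((\<lambda>\<xi>. real k *\<^sub>R \<xi>) ` \<Delta>') m f)"
proof -
  obtain I :: "(nat \<Rightarrow> real) set set" and a b
    where pres: "smooth_presentation n I a b" and \<Delta>': "\<Delta>' = hpoly n I a b"
    using smooth_polytope_presentation[OF assms(1)] by (elim exE conjE)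
  interpret P: smooth_presentation n I a b by (rule pres)
  let ?V = "{v. v extreme_point_of hpoly n I a b}"
  have int: "\<forall>v. v extreme_point_of hpoly n I a b \<longrightarrow> v \<in> Zlattice n"
    using assms(2) unfolding integral_vertices_def \<Delta>'[symmetric] .
  have finV: "finite ?V" by (rule finite_extreme_points_hpoly[OF P.finite_index])
  obtain y where "y \<in> hpoly n I a b" using P.hpoly_nonempty by auto
  then obtain v where "v extreme_point_of hpoly n I a b" by (rule P.vertex_beyond)
  then have Vne: "?V \<noteq> {}" by auto
  define k where "k = 2 * card ?V"
  define x0 where "x0 = 2 *\<^sub>R (\<Sum>v\<in>?V. v)"
  have k: "k > 0" using finV Vne by (simp add: k_def card_gt_0_iff)
  have x0Z: "x0 \<in> Zlattice n"
    using Zlattice_scale[OF Zlattice_sum[of ?V "\<lambda>v. v" n], of 2] int by (simp add: x0_def)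
  then have x0R: "x0 \<in> Rspace n" by (rule Zlattice_imp_Rspace)
  have "\<forall>F\<in>I. \<exists>r::nat. 1 \<le> r \<and> 1 + real r = real k * b F - pairing n (a F) x0"
  proof
    fix F assume F: "F \<in> I"
    obtain s :: nat where s: "1 \<le> s" "(\<Sum>v\<in>?V. b F - pairing n (a F) v) = real s"
      using P.vertex_slack_sum[OF int F] by (elim exE conjE)
    have "real k * b F - pairing n (a F) x0 = 2 * (\<Sum>v\<in>?V. b F - pairing n (a F) v)"
      by (simp add: k_def x0_def pairing_scaleR_right pairing_sum_right sum_subtractf algebra_simps)
    also have "\<dots> = 1 + real (2 * s - 1)" unfolding s(2) using s(1) by (simp add: of_nat_diff)
    finally show "\<exists>r::nat. 1 \<le> r \<and> 1 + real r = real k * b F - pairing n (a F) x0"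
      using s(1) by (intro exI[of _ "2 * s - 1"]) simp
  qed
  then obtain r :: "(nat \<Rightarrow> real) set \<Rightarrow> nat"
    where r: "\<forall>F\<in>I. 1 \<le> r F \<and> 1 + real (r F) = real k * b F - pairing n (a F) x0"
    by (rule bchoice[THEN exE])
  have b': "\<forall>F\<in>I. 1 + real (r F) = real k * b F - pairing n (a F) x0"
    using r by simp
  have kpos: "real k > 0" using k by simp
  have core: "smooth_presentation n I a (\<lambda>F. 1 + real (r F))"
    by (rule smooth_presentation_dilate[OF pres kpos x0R b'])
  interpret E: facet_expansion n I a r
    by (intro facet_expansion.intro core facet_expansion_axioms.intro) (use r in simp)
  let ?\<Delta> = "hpoly E.total_dim E.labels E.conormal (\<lambda>_. 1)"
  let ?f = "hface E.total_dim E.labels E.conormal (\<lambda>_. 1) E.fibre_labels"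
  \<comment> \<open>Adding \<open>- x0\<close> passes from the multiple of \<open>\<Delta>'\<close> to the core polytope, and adding \<open>E.offset\<close> to the
    face, so the affine equivalence is a translation.\<close>
  define shift where "shift = E.offset - x0"
  have offZ: "E.offset \<in> Zlattice E.total_dim"
    unfolding E.offset_def by (rule E.lift_Zlattice) (simp_all add: Zlattice_zero)
  have up: "x \<in> Zlattice E.total_dim" if "x \<in> Zlattice n" for x
    using that by (auto simp: Zlattice_iff Rspace_def E.total_dim_def)
  have shiftZ: "shift \<in> Zlattice E.total_dim"
    unfolding shift_def by (rule Zlattice_diff[OF offZ up[OF x0Z]])
  let ?P = "(\<lambda>\<xi>. real k *\<^sub>R \<xi>) ` \<Delta>'"
  have f: "?f = (\<lambda>x. shift + x) ` ?P"
  proof -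
    have "?f = (\<lambda>x. E.offset + x) ` (\<lambda>\<xi>. real k *\<^sub>R \<xi> - x0) ` \<Delta>'"
      unfolding E.core_face \<Delta>' hpoly_dilate(1)[OF kpos x0R b'] by (rule refl)
    also have "\<dots> = (\<lambda>x. shift + x) ` ?P"
      unfolding image_image shift_def by (rule image_cong[OF refl]) simp
    finally show ?thesis .
  qed
  have hull: "affine hull ?f = (\<lambda>x. shift + x) ` (affine hull ?P)"
    unfolding f by (rule affine_hull_translation)
  have PR: "affine hull ?P \<subseteq> Rspace n"
  proof (rule hull_minimal)
    show "?P \<subseteq> Rspace n"
      unfolding \<Delta>' by (rule image_subsetI) (simp add: hpoly_def Rspace_closed(3))
    show "affine (Rspace n)" by (rule subspace_imp_affine[OF subspace_Rspace])
  qed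
  have equiv: "integrally_affine_equivalent n ?P E.total_dim ?f"
    unfolding integrally_affine_equivalent_def Let_def
  proof (intro exI[of _ "\<lambda>x. x"] exI[of _ shift] conjI)
    have comm: "(\<lambda>x. x + shift) = (\<lambda>x. shift + x)" by (simp add: add.commute)
    show "linear (\<lambda>x::nat \<Rightarrow> real. x)" by (rule linear_ident)
    show "bij_betw (\<lambda>x. x + shift) (affine hull ?P) (affine hull ?f)"
      unfolding comm hull by (rule inj_on_imp_bij_betw) simp
    show "(\<lambda>x. x + shift) ` ?P = ?f" unfolding comm f by (rule refl)
    show "(\<lambda>x. x + shift) ` (affine hull ?P \<inter> Zlattice n) = affine hull ?f \<inter> Zlattice E.total_dim"
      unfolding comm hull
    proof
      show "(\<lambda>x. shift + x) ` (affine hull ?P \<inter> Zlattice n) \<subseteq>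
          (\<lambda>x. shift + x) ` (affine hull ?P) \<inter> Zlattice E.total_dim"
        using Zlattice_add[OF shiftZ up] by auto
      show "(\<lambda>x. shift + x) ` (affine hull ?P) \<inter> Zlattice E.total_dim \<subseteq>
          (\<lambda>x. shift + x) ` (affine hull ?P \<inter> Zlattice n)"
      proof
        fix y assume y: "y \<in> (\<lambda>x. shift + x) ` (affine hull ?P) \<inter> Zlattice E.total_dim"
        then obtain x where x: "y = shift + x" "x \<in> affine hull ?P" by (elim IntE imageE)
        have "x = y - shift" by (simp add: x(1))
        then have "x \<in> Zlattice E.total_dim" using Zlattice_diff[of y E.total_dim shift] y shiftZ by simp
        then have "x \<in> Zlattice n" using subsetD[OF PR x(2)] by (simp add: Zlattice_iff)
        then show "y \<in> (\<lambda>x. shift + x) ` (affine hull ?P \<inter> Zlattice n)"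
          using x by (intro image_eqI[where x = x]) simp_all
      qed
    qed
  qed
  have mono: "monotone_polytope E.total_dim ?\<Delta>" by (rule E.expanded.monotone_polytope_hpoly) simp
  have "\<forall>F. is_facet ?\<Delta> F \<longrightarrow> is_pervasive ?\<Delta> F \<and> is_powerful ?\<Delta> F"
    using E.facets_pervasive E.facets_powerful by simp
  with mono hface_face_of[OF E.fibre_labels_subset] equiv k show ?thesis
    by (intro exI[of _ k] conjI exI[of _ E.total_dim] exI[of _ ?\<Delta>] exI[of _ ?f])
qed

end
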